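(* Let $X$ be a rigid $\mathcal{B}$-group and let $R := R(X) = \bigoplus_{\rho \in T_{cr}(X)} R_\rho$ be the homogeneous decomposition of its regulator. Then $X$ has a description $X = R + \frac{\mathbb{Z}}{e} \sum_{\rho \in T_{cr}(X)} \alpha_\rho v_\rho$ where (1) $\{v_\rho \mid \rho \in T_{cr}(R)\}$ is a decomposition basis of $R$, so $R = \bigoplus_{\rho \in T_{cr}(X)} \rho v_\rho$; (2) for all $\tau \in T_{cr}(X)$, $\gcd^R\bigl(e,\sum_{\rho \neq \tau} \alpha_\rho v_\rho\bigr) = 1$; (3) $e = [X : R]$; (4) each $\alpha_\rho$ is an integral factor of $e$; and (5) for all $\tau \in T_{cr}(X)$, $\mu_\tau(X) = \frac{e}{\alpha_\tau}$. If $\operatorname{rk}(X) = 2$ and $[X:R]=e$, then there is a decomposition basis $\{v_1,v_2\}$ of $R = \tau_1 v_1 \oplus \tau_2 v_2$ such that $X = R + \mathbb{Z} e^{-1}(v_1 + v_2)$ with $\gcd^R(e,v_i) = 1$ for $i=1,2$.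
   Context: All groups are torsion-free abelian of finite rank. Types are isomorphism classes of rank-one groups, with $\sigma\le\tau$ iff there is a nonzero homomorphism from a group of type $\sigma$ to one of type $\tau$. A completely decomposable group is a direct sum of rank-one groups; its homogeneous decomposition is $A=\bigoplus_{\rho\in T_{cr}(A)}A_\rho$, where $A_\rho\neq 0$ is a direct sum of rank-one groups of type $\rho$, and $T_{cr}(A)$ is the critical typeset of $A$. An almost completely decomposable group is a group $X$ containing a completely decomposable subgroup of finite index; the completely decomposable subgroups of least index in $X$ are its regulating subgroups, and the regulator $R(X)$ is the intersection of all of them (it is completely decomposable, fully invariant, of finite index in $X$). Put $T_{cr}(X)=T_{cr}(R(X))$. $X$ is block-rigid if $T_{cr}(X)$ is an antichain, and rigid if moreover every $\operatorname{rk}(R(X)_\rho)=1$. $\mathcal{B}$ is the class of block-rigid almost completely decomposable groups $X$ with $X/R(X)$ cyclic; its members are called $\mathcal{B}$-groups. A rational group is an additive subgroup of $\mathbb{Q}$ containing $1$. A completely decomposable group of rank $r$ can be written $A=\bigoplus_{i=1}^r \tau_i v_i$ where the $\tau_iv_i$ are rank-one summands, $0\ne v_i$ lies in that summand, and $\tau_i=\{x\in\mathbb{Q}\mid xv_i\in A\}$ is a rational group; then $\{v_1,\dots,v_r\}$ is called a decomposition basis of $A$. The same symbol is used for a rational group and its type. For a positive integer $e$ and $a\in A$, $\gcd^A(e,a)=d$ where $m=\operatorname{ord}(a+eA)$ in $A/eA$ and $e=md$. Invariants: for a $\mathcal{B}$-group $X$ with regulator $R$, write $X=R+\mathbb{Z}e^{-1}a$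 with $e$ a positive integer such that $eX\subseteq R$ and $a=\sum_{\rho\in T_{cr}(X)} a_\rho\in R$, $a_\rho\in R_\rho$; then $\mu_\tau(X)=\operatorname{ord}(a_\tau+eR)$ (with $a_\tau=0$ if $\tau\notin T_{cr}(X)$), which is independent of the choices of $e$ and $a$. *)

theory Defs
  imports Complex_Main "HOL-Algebra.Elementary_Groups" "HOL-Algebra.Multiplicative_Group"
begin

text \<open>
  Abelian groups are commutative groups of HOL-Algebra and hence written multiplicatively: the
  informal \<open>x + y\<close>, \<open>n x\<close>, \<open>0\<close> and \<open>\<Sum>\<close> are \<open>x \<otimes> y\<close>, \<open>x [^] n\<close>, \<open>\<one>\<close> and \<open>\<Otimes>\<close>. Notions for a
  group \<open>A\<close> that occurs as a subgroup take an ambient group \<open>G\<close> and the subset \<open>A\<close> of its carrier.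
\<close>

section \<open>Torsion-free groups of finite rank\<close>

definition torsion_free :: "('a, 'b) monoid_scheme \<Rightarrow> bool" where
  "torsion_free G \<longleftrightarrow>
     (\<forall>x\<in>carrier G. \<forall>n::nat. 0 < n \<longrightarrow> x [^]\<^bsub>G\<^esub> n = \<one>\<^bsub>G\<^esub> \<longrightarrow> x = \<one>\<^bsub>G\<^esub>)"

definition Z_independent :: "('a, 'b) monoid_scheme \<Rightarrow> 'a set \<Rightarrow> bool" where
  "Z_independent G B \<longleftrightarrow> finite B \<and> B \<subseteq> carrier G \<and>
     (\<forall>c :: 'a \<Rightarrow> int. (\<Otimes>\<^bsub>G\<^esub>b\<in>B. b [^]\<^bsub>G\<^esub> c b) = \<one>\<^bsub>G\<^esub> \<longrightarrow> (\<forall>b\<in>B. c b = 0))"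

definition finite_rank :: "('a, 'b) monoid_scheme \<Rightarrow> bool" where
  "finite_rank G \<longleftrightarrow> (\<exists>n. \<forall>B. Z_independent G B \<longrightarrow> card B \<le> n)"

definition rk :: "('a, 'b) monoid_scheme \<Rightarrow> 'a set \<Rightarrow> nat" where
  "rk G A = Sup {card B | B. B \<subseteq> A \<and> Z_independent G B}"

definition tffr_group :: "('a, 'b) monoid_scheme \<Rightarrow> bool" where
  "tffr_group G \<longleftrightarrow> comm_group G \<and> torsion_free G \<and> finite_rank G"

section \<open>Rational groups and types\<close>

definition rat_group :: "rat set \<Rightarrow> rat monoid" where
  "rat_group S = \<lparr>carrier = S, monoid.mult = (+), one = 0\<rparr>"

definition rational_group :: "rat set \<Rightarrow> bool" where
  "rational_group S \<longleftrightarrow> subgroup S (rat_group UNIV) \<and> 1 \<in> S"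

text \<open>
  Every torsion-free group of rank one is isomorphic to a rational group, so an isomorphism class
  of rank-one groups is represented by the set of all rational groups belonging to it.
\<close>

type_synonym rtype = "rat set set"

definition type_of :: "('a, 'b) monoid_scheme \<Rightarrow> 'a set \<Rightarrow> rtype" where
  "type_of G A = {S. rational_group S \<and> rat_group S \<cong> G\<lparr>carrier := A\<rparr>}"

definition type_le :: "rtype \<Rightarrow> rtype \<Rightarrow> bool" where
  "type_le \<sigma> \<tau> \<longleftrightarrow>
     (\<exists>S\<in>\<sigma>. \<exists>T\<in>\<tau>. \<exists>h\<in>hom (rat_group S) (rat_group T). \<exists>x\<in>S. h x \<noteq> 0)"

section \<open>Completely decomposable groups\<close>

text \<open>\<open>A\<close> is the internal direct sum of the finite family \<open>F\<close> of subgroups of \<open>G\<close>.\<close>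

definition direct_decomp ::
  "('a, 'b) monoid_scheme \<Rightarrow> 'a set \<Rightarrow> 'i set \<Rightarrow> ('i \<Rightarrow> 'a set) \<Rightarrow> bool" where
  "direct_decomp G A I F \<longleftrightarrow> finite I \<and> (\<forall>i\<in>I. subgroup (F i) G) \<and>
     bij_betw (\<lambda>f. \<Otimes>\<^bsub>G\<^esub>i\<in>I. f i) (\<Pi>\<^sub>E i\<in>I. F i) A"

definition completely_decomposable :: "('a, 'b) monoid_scheme \<Rightarrow> 'a set \<Rightarrow> bool" where
  "completely_decomposable G A \<longleftrightarrow>
     (\<exists>(n::nat) F. direct_decomp G A {..<n} F \<and> (\<forall>i<n. rk G (F i) = 1))"

definition homogeneous :: "('a, 'b) monoid_scheme \<Rightarrow> rtype \<Rightarrow> 'a set \<Rightarrow> bool" where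
  "homogeneous G \<rho> A \<longleftrightarrow>
     (\<exists>(n::nat) F. direct_decomp G A {..<n} F \<and>
        (\<forall>i<n. rk G (F i) = 1 \<and> type_of G (F i) = \<rho>))"

definition homogeneous_decomposition ::
  "('a, 'b) monoid_scheme \<Rightarrow> 'a set \<Rightarrow> rtype set \<Rightarrow> (rtype \<Rightarrow> 'a set) \<Rightarrow> bool" where
  "homogeneous_decomposition G A T F \<longleftrightarrow> direct_decomp G A T F \<and>
     (\<forall>\<rho>\<in>T. F \<rho> \<noteq> {\<one>\<^bsub>G\<^esub>} \<and> homogeneous G \<rho> (F \<rho>))"

text \<open>The index set of a homogeneous decomposition is uniquely determined by the group.\<close>

definition critical_typeset :: "('a, 'b) monoid_scheme \<Rightarrow> 'a set \<Rightarrow> rtype set" where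
  "critical_typeset G A = {\<rho>. \<exists>T F. homogeneous_decomposition G A T F \<and> \<rho> \<in> T}"

text \<open>
  In a torsion-free group \<open>G\<close> there is at most one \<open>y\<close> with \<open>y = q v\<close>; as a subgroup of its
  divisible hull, \<open>G\<close> contains \<open>q v\<close> iff such a \<open>y\<close> exists.
\<close>

definition is_rat_multiple :: "('a, 'b) monoid_scheme \<Rightarrow> rat \<Rightarrow> 'a \<Rightarrow> 'a \<Rightarrow> bool" where
  "is_rat_multiple G q v y \<longleftrightarrow>
     (\<exists>m n :: int. 0 < n \<and> q = of_int m / of_int n \<and> y [^]\<^bsub>G\<^esub> n = v [^]\<^bsub>G\<^esub> m)"

text \<open>The rational group \<open>{x \<in> \<rat> | x v \<in> A}\<close>, and the group \<open>S v\<close> for a set \<open>S\<close> of rationals.\<close>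

definition coeff_group :: "('a, 'b) monoid_scheme \<Rightarrow> 'a set \<Rightarrow> 'a \<Rightarrow> rat set" where
  "coeff_group G A v = {q. \<exists>y\<in>A. is_rat_multiple G q v y}"

definition rat_multiples :: "('a, 'b) monoid_scheme \<Rightarrow> rat set \<Rightarrow> 'a \<Rightarrow> 'a set" where
  "rat_multiples G S v = {y \<in> carrier G. \<exists>q\<in>S. is_rat_multiple G q v y}"

definition decomposition_basis :: "('a, 'b) monoid_scheme \<Rightarrow> 'a set \<Rightarrow> 'a set \<Rightarrow> bool" where
  "decomposition_basis G A V \<longleftrightarrow> V \<subseteq> A - {\<one>\<^bsub>G\<^esub>} \<and>
     direct_decomp G A V (\<lambda>v. rat_multiples G (coeff_group G A v) v) \<and>
     (\<forall>v\<in>V. rk G (rat_multiples G (coeff_group G A v) v) = 1)"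

section \<open>Almost completely decomposable groups\<close>

definition finite_index_cd :: "('a, 'b) monoid_scheme \<Rightarrow> 'a set \<Rightarrow> bool" where
  "finite_index_cd X W \<longleftrightarrow>
     subgroup W X \<and> completely_decomposable X W \<and> finite (rcosets\<^bsub>X\<^esub> W)"

definition almost_completely_decomposable :: "('a, 'b) monoid_scheme \<Rightarrow> bool" where
  "almost_completely_decomposable X \<longleftrightarrow> tffr_group X \<and> (\<exists>W. finite_index_cd X W)"

definition regulating :: "('a, 'b) monoid_scheme \<Rightarrow> 'a set \<Rightarrow> bool" where
  "regulating X W \<longleftrightarrow> finite_index_cd X W \<and>
     (\<forall>W'. finite_index_cd X W' \<longrightarrow> card (rcosets\<^bsub>X\<^esub> W) \<le> card (rcosets\<^bsub>X\<^esub> W'))"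

definition regulator :: "('a, 'b) monoid_scheme \<Rightarrow> 'a set" where
  "regulator X = \<Inter>{W. regulating X W}"

definition Tcr :: "('a, 'b) monoid_scheme \<Rightarrow> rtype set" where
  "Tcr X = critical_typeset X (regulator X)"

definition block_rigid :: "('a, 'b) monoid_scheme \<Rightarrow> bool" where
  "block_rigid X \<longleftrightarrow> (\<forall>\<sigma>\<in>Tcr X. \<forall>\<tau>\<in>Tcr X. type_le \<sigma> \<tau> \<longrightarrow> \<sigma> = \<tau>)"

definition rigid :: "('a, 'b) monoid_scheme \<Rightarrow> bool" where
  "rigid X \<longleftrightarrow> block_rigid X \<and>
     (\<forall>F. homogeneous_decomposition X (regulator X) (Tcr X) F \<longrightarrow> (\<forall>\<rho>\<in>Tcr X. rk X (F \<rho>) = 1))"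

definition B_group :: "('a, 'b) monoid_scheme \<Rightarrow> bool" where
  "B_group X \<longleftrightarrow>
     almost_completely_decomposable X \<and> block_rigid X \<and> cyclic_group (X Mod regulator X)"

section \<open>Invariants\<close>

text \<open>\<open>ord_mod G A e a\<close> is the order of \<open>a + eA\<close> in \<open>A/eA\<close>; it divides \<open>e\<close>.\<close>

definition ord_mod :: "('a, 'b) monoid_scheme \<Rightarrow> 'a set \<Rightarrow> nat \<Rightarrow> 'a \<Rightarrow> nat" where
  "ord_mod G A e a =
     (let eA = (\<lambda>x. x [^]\<^bsub>G\<^esub> e) ` A
      in group.ord (G\<lparr>carrier := A\<rparr> Mod eA) (eA #>\<^bsub>G\<^esub> a))"

definition gcd_in :: "('a, 'b) monoid_scheme \<Rightarrow> 'a set \<Rightarrow> nat \<Rightarrow> 'a \<Rightarrow> nat" where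
  "gcd_in G A e a = e div ord_mod G A e a"

text \<open>\<open>X = R + \<int>e\<^sup>-\<^sup>1a\<close>, where \<open>e\<^sup>-\<^sup>1a\<close> is the unique \<open>x\<close> with \<open>e x = a\<close>.\<close>

definition described_by :: "('a, 'b) monoid_scheme \<Rightarrow> 'a set \<Rightarrow> nat \<Rightarrow> 'a \<Rightarrow> bool" where
  "described_by X R e a \<longleftrightarrow> 0 < e \<and>
     (\<exists>x\<in>carrier X. x [^]\<^bsub>X\<^esub> e = a \<and>
        carrier X = R <#>\<^bsub>X\<^esub> range (\<lambda>k::int. x [^]\<^bsub>X\<^esub> k))"

definition mu :: "('a, 'b) monoid_scheme \<Rightarrow> rtype \<Rightarrow> nat" where
  "mu X \<tau> = (THE m. \<exists>e F a.
     homogeneous_decomposition X (regulator X) (Tcr X) F \<and>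
     (\<forall>x\<in>carrier X. x [^]\<^bsub>X\<^esub> e \<in> regulator X) \<and>
     a \<in> (\<Pi> \<rho>\<in>Tcr X. F \<rho>) \<and>
     described_by X (regulator X) e (\<Otimes>\<^bsub>X\<^esub>\<rho>\<in>Tcr X. a \<rho>) \<and>
     m = ord_mod X (regulator X) e (if \<tau> \<in> Tcr X then a \<tau> else \<one>\<^bsub>X\<^esub>))"

end

theory Submission
  imports Defs
begin

text \<open>
  Let \<open>X = R + \<int>x\<close> with \<open>e = [X : R]\<close>, so \<open>e x = \<Sum> a\<^sub>\<rho> \<in> R\<close>. Minimality of the index makes the
  rank-one summands of a regulating subgroup pure in \<open>X\<close>, and since the critical types form an
  antichain, each \<open>R\<^sub>\<tau>\<close> lies in one such summand; hence \<open>R\<^sub>\<tau>\<close> is pure in \<open>X\<close>. If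
  \<open>k \<Sum>\<^bsub>\<rho> \<noteq> \<tau>\<^esub> a\<^sub>\<rho> \<in> eR\<close>, then \<open>k x\<close> is congruent modulo \<open>R\<close> to an element of the purification of
  \<open>R\<^sub>\<tau>\<close>, so \<open>k x \<in> R\<close> and \<open>e\<close> divides \<open>k\<close>; this is (2). For the basis, put
  \<open>\<alpha>\<^sub>\<rho> = e / ord(a\<^sub>\<rho> + eR)\<close>. Then \<open>a\<^sub>\<rho> = \<alpha>\<^sub>\<rho> v\<^sub>\<rho>\<close> for some \<open>v\<^sub>\<rho> \<in> R\<^sub>\<rho>\<close>, and if \<open>a\<^sub>\<rho> = 0\<close>, it may be
  replaced by \<open>e v\<^sub>\<rho>\<close> with any nonzero \<open>v\<^sub>\<rho>\<close>. In rank two, (2) forces both \<open>\<alpha>\<^sub>\<rho>\<close> to be \<open>1\<close>.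
\<close>

section \<open>Torsion-free abelian groups\<close>

locale torsion_free_group = comm_group G for G (structure) +
  assumes torsion_free: "torsion_free G"
begin

lemma int_pow_eq_one_iff:
  assumes "x \<in> carrier G"
  shows "x [^] (n::int) = \<one> \<longleftrightarrow> n = 0 \<or> x = \<one>"
proof -
  have pos: "x = \<one>" if "0 < k" "x [^] (k::int) = \<one>" for k
  proof -
    have "x [^] nat k = \<one>" using that int_pow_int[of G x "nat k"] by simp
    then show ?thesis using torsion_free assms that(1) unfolding torsion_free_def
      by (metis zero_less_nat_eq)
  qed
  have "x = \<one>" if "n \<noteq> 0" "x [^] n = \<one>"
    using pos[of n] pos[of "-n"] that assms by (cases "0 < n") (auto simp: int_pow_neg)
  then show ?thesis by auto
qed

lemma int_pow_cancel:
  assumes "x \<in> carrier G" "y \<in> carrier G" "x [^] (n::int) = y [^] n" "n \<noteq> 0"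
  shows "x = y"
proof -
  have "(x \<otimes> inv y) [^] n = \<one>"
    using assms by (simp add: int_pow_distrib int_pow_inv)
  then have "x \<otimes> inv y = \<one>" using assms int_pow_eq_one_iff[of "x \<otimes> inv y" n] by auto
  then show ?thesis using assms by (metis inv_closed inv_equality inv_inv)
qed

lemma pow_cancel:
  assumes "x \<in> carrier G" "y \<in> carrier G" "x [^] (n::nat) = y [^] n" "0 < n"
  shows "x = y"
  using int_pow_cancel[of x y "int n"] assms by (simp add: int_pow_int)

end

section \<open>Internal direct sums\<close>

lemma (in comm_group) finprod_pow:
  assumes "f \<in> I \<rightarrow> carrier G"
  shows "(\<Otimes>i\<in>I. f i [^] (n::int)) = (\<Otimes>i\<in>I. f i) [^] n"
  using assms
proof (induction I rule: infinite_finite_induct)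
  case (insert i I)
  then show ?case by (simp add: int_pow_distrib Pi_iff)
qed auto

locale direct_sum = comm_group G for G (structure) +
  fixes A :: "'a set" and I :: "'i set" and F :: "'i \<Rightarrow> 'a set"
  assumes decomp: "direct_decomp G A I F"
begin

text \<open>Coordinates come from inverting the sum map, so they are meaningful only on
  \<open>A\<close>. Elements of a larger group must be multiplied into \<open>A\<close> before their
  coordinates are taken.\<close>

definition component :: "'i \<Rightarrow> 'a \<Rightarrow> 'a" where
  "component i y = inv_into (\<Pi>\<^sub>E i\<in>I. F i) (\<lambda>f. \<Otimes>i\<in>I. f i) y i"

lemma finite_index: "finite I"
  and summand_subgroup: "i \<in> I \<Longrightarrow> subgroup (F i) G"
  and bij: "bij_betw (\<lambda>f. \<Otimes>i\<in>I. f i) (\<Pi>\<^sub>E i\<in>I. F i) A"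
  using decomp unfolding direct_decomp_def by auto

lemma summand_carrier: "i \<in> I \<Longrightarrow> F i \<subseteq> carrier G"
  using summand_subgroup subgroup.subset by blast

lemma family_carrier: "f \<in> Pi I F \<Longrightarrow> f \<in> I \<rightarrow> carrier G"
  using summand_carrier by blast

lemma component_in: "y \<in> A \<Longrightarrow> i \<in> I \<Longrightarrow> component i y \<in> F i"
  unfolding component_def using bij inv_into_into[of y "\<lambda>f. \<Otimes>i\<in>I. f i" "\<Pi>\<^sub>E i\<in>I. F i"]
  by (auto simp: bij_betw_def)

lemma component_carrier: "y \<in> A \<Longrightarrow> i \<in> I \<Longrightarrow> component i y \<in> carrier G"
  using component_in summand_carrier by blast

lemma finprod_component: "y \<in> A \<Longrightarrow> (\<Otimes>i\<in>I. component i y) = y"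
  unfolding component_def using bij f_inv_into_f[of y "\<lambda>f. \<Otimes>i\<in>I. f i" "\<Pi>\<^sub>E i\<in>I. F i"]
  by (auto simp: bij_betw_def)

text \<open>The bijection in \<open>direct_decomp\<close> concerns extensional functions. Cutting a
  family off outside \<open>I\<close> makes it one without changing its sum, which lets later proofs
  work with arbitrary families.\<close>

lemma finprod_restrict:
  assumes "f \<in> Pi I F" shows "(\<Otimes>i\<in>I. restrict f I i) = (\<Otimes>i\<in>I. f i)"
  using family_carrier[OF assms] by (intro finprod_cong') auto

lemma finprod_in:
  assumes "f \<in> Pi I F" shows "(\<Otimes>i\<in>I. f i) \<in> A"
proof -
  have "restrict f I \<in> (\<Pi>\<^sub>E i\<in>I. F i)" using assms by auto
  then have "(\<Otimes>i\<in>I. restrict f I i) \<in> A" by (rule bspec[OF bij_betwE[OF bij]])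
  then show ?thesis using finprod_restrict[OF assms] by simp
qed

lemma component_finprod:
  assumes "f \<in> Pi I F" "i \<in> I" shows "component i (\<Otimes>i\<in>I. f i) = f i"
proof -
  have "restrict f I \<in> (\<Pi>\<^sub>E i\<in>I. F i)" using assms by auto
  then have "inv_into (\<Pi>\<^sub>E i\<in>I. F i) (\<lambda>f. \<Otimes>i\<in>I. f i) (\<Otimes>i\<in>I. restrict f I i) = restrict f I"
    using bij by (intro inv_into_f_f) (auto simp: bij_betw_def)
  then show ?thesis unfolding component_def finprod_restrict[OF assms(1)]
    using assms(2) by simp
qed

lemma in_carrier: "y \<in> A \<Longrightarrow> y \<in> carrier G"
  by (metis finprod_component finprod_closed component_carrier Pi_I)

lemma one_in: "\<one> \<in> A"
  using finprod_in[of "\<lambda>_. \<one>"] summand_subgroup subgroup.one_closed by fastforce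

text \<open>The family of componentwise products has product \<open>y \<otimes> z\<close>;
  membership follows at once, and additivity of the coordinates follows from their
  uniqueness.\<close>

lemma mult_in_component:
  assumes "y \<in> A" "z \<in> A"
  shows "y \<otimes> z \<in> A" "i \<in> I \<Longrightarrow> component i (y \<otimes> z) = component i y \<otimes> component i z"
proof -
  let ?f = "\<lambda>i. component i y \<otimes> component i z"
  have f: "?f \<in> Pi I F"
    using component_in assms summand_subgroup subgroup.m_closed by (metis (no_types, lifting) Pi_I)
  have "(\<Otimes>i\<in>I. ?f i) = (\<Otimes>i\<in>I. component i y) \<otimes> (\<Otimes>i\<in>I. component i z)"
    using assms component_carrier by (intro finprod_multf) auto
  then have eq: "(\<Otimes>i\<in>I. ?f i) = y \<otimes> z" using finprod_component assms by simp
  show "y \<otimes> z \<in> A" using finprod_in[OF f] eq by simp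
  show "i \<in> I \<Longrightarrow> component i (y \<otimes> z) = component i y \<otimes> component i z"
    using component_finprod[OF f] eq by simp
qed

lemma int_pow_in_component:
  assumes "y \<in> A"
  shows "y [^] (n::int) \<in> A" "i \<in> I \<Longrightarrow> component i (y [^] n) = component i y [^] n"
proof -
  let ?f = "\<lambda>i. component i y [^] n"
  have f: "?f \<in> Pi I F"
    using component_in assms summand_subgroup subgroup_int_pow_closed by blast
  have "(\<Otimes>i\<in>I. ?f i) = (\<Otimes>i\<in>I. component i y) [^] n"
    using assms component_carrier by (intro finprod_pow) auto
  then have eq: "(\<Otimes>i\<in>I. ?f i) = y [^] n" using finprod_component assms by simp
  show "y [^] n \<in> A" using finprod_in[OF f] eq by simp
  show "i \<in> I \<Longrightarrow> component i (y [^] n) = component i y [^] n"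
    using component_finprod[OF f] eq by simp
qed

lemmas mult_in = mult_in_component(1)
lemmas component_mult = mult_in_component(2)
lemmas int_pow_in = int_pow_in_component(1)
lemmas component_int_pow = int_pow_in_component(2)

lemma sum_subgroup: "subgroup A G"
proof (rule subgroupI)
  show "A \<subseteq> carrier G" using in_carrier by blast
  show "A \<noteq> {}" using one_in by blast
  show "inv a \<in> A" if "a \<in> A" for a
    using int_pow_in[OF that, of "-1"] in_carrier[OF that] by (simp add: int_pow_neg)
qed (rule mult_in)

lemma component_hom:
  "i \<in> I \<Longrightarrow> component i \<in> hom (G\<lparr>carrier := A\<rparr>) (G\<lparr>carrier := F i\<rparr>)"
  by (auto simp: hom_def component_in component_mult)

lemma component_eqI:
  assumes "y \<in> A" "z \<in> A" "\<And>i. i \<in> I \<Longrightarrow> component i y = component i z"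
  shows "y = z"
proof -
  have "(\<Otimes>i\<in>I. component i y) = (\<Otimes>i\<in>I. component i z)"
    using assms component_carrier by (intro finprod_cong') auto
  then show ?thesis using assms finprod_component by simp
qed

lemma summand:
  assumes "i \<in> I" "y \<in> F i"
  shows summand_in: "y \<in> A"
    and component_summand: "j \<in> I \<Longrightarrow> component j y = (if j = i then y else \<one>)"
proof -
  let ?f = "\<lambda>j. if i = j then y else \<one>"
  have f: "?f \<in> Pi I F" using assms summand_subgroup subgroup.one_closed by fastforce
  have eq: "(\<Otimes>j\<in>I. ?f j) = y"
    using finprod_singleton[of i I "\<lambda>_. y"] assms finite_index summand_carrier by auto
  show "y \<in> A" using finprod_in[OF f] eq by simp
  show "j \<in> I \<Longrightarrow> component j y = (if j = i then y else \<one>)"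
    using component_finprod[OF f] eq by auto
qed

lemma in_summandI:
  assumes "y \<in> A" "i \<in> I" "\<And>j. j \<in> I \<Longrightarrow> j \<noteq> i \<Longrightarrow> component j y = \<one>"
  shows "y \<in> F i"
proof -
  have "component i y = y"
  proof (rule component_eqI)
    have i: "component i y \<in> F i" using assms component_in by blast
    show "component i y \<in> A" using summand_in[OF assms(2) i] .
    show "component j (component i y) = component j y" if "j \<in> I" for j
      using component_summand[OF assms(2) i that] assms(3)[OF that] by auto
  qed (rule assms(1))
  then show ?thesis using component_in assms by metis
qed

lemma finprod_subset_in:
  assumes "J \<subseteq> I" "f \<in> Pi J F"
  shows "(\<Otimes>j\<in>J. f j) \<in> A"
proof -
  let ?f = "\<lambda>j. if j \<in> J then f j else \<one>"
  have f: "?f \<in> Pi I F" using assms summand_subgroup subgroup.one_closed by fastforce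
  have "(\<Otimes>j\<in>J. f j) = (\<Otimes>j\<in>I. ?f j)"
    using assms finite_index family_carrier[OF f]
    by (intro finprod_mono_neutral_cong_left) (auto split: if_splits)
  then show ?thesis using finprod_in[OF f] by simp
qed

text \<open>\<open>decomposition_basis\<close> indexes the summands by the basis elements
  themselves, a homogeneous decomposition by types; this passes from the latter to the former. With
  the identity as \<open>v\<close> it replaces the summands by equal ones.\<close>

lemma direct_decomp_reindex:
  assumes v: "inj_on v I" and E: "\<And>i. i \<in> I \<Longrightarrow> E (v i) = F i"
  shows "direct_decomp G A (v ` I) E"
  unfolding direct_decomp_def
proof (intro conjI)
  show "finite (v ` I)" using finite_index by simp
  show "\<forall>w\<in>v ` I. subgroup (E w) G" using E summand_subgroup by auto
  have mem: "(\<lambda>i. f (v i)) \<in> Pi I F" if "f \<in> (\<Pi>\<^sub>E w\<in>v ` I. E w)" for f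
    using PiE_mem[OF that] E by auto
  have reindex: "(\<Otimes>w\<in>v ` I. f w) = (\<Otimes>i\<in>I. f (v i))" if f: "f \<in> (\<Pi>\<^sub>E w\<in>v ` I. E w)" for f
  proof (rule finprod_reindex[OF _ v])
    show "f \<in> v ` I \<rightarrow> carrier G" using family_carrier[OF mem[OF f]] by auto
  qed
  show "bij_betw (\<lambda>f. \<Otimes>w\<in>v ` I. f w) (\<Pi>\<^sub>E w\<in>v ` I. E w) A"
    unfolding bij_betw_def
  proof (intro conjI subset_antisym subsetI)
    show "inj_on (\<lambda>f. \<Otimes>w\<in>v ` I. f w) (\<Pi>\<^sub>E w\<in>v ` I. E w)"
    proof (rule inj_onI)
      fix f g assume f: "f \<in> (\<Pi>\<^sub>E w\<in>v ` I. E w)" and g: "g \<in> (\<Pi>\<^sub>E w\<in>v ` I. E w)"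
        and eq: "(\<Otimes>w\<in>v ` I. f w) = (\<Otimes>w\<in>v ` I. g w)"
      show "f = g"
      proof (rule PiE_ext[OF f g])
        fix w assume "w \<in> v ` I"
        then obtain i where "i \<in> I" "w = v i" by blast
        then show "f w = g w"
          using eq component_finprod[OF mem[OF f]] component_finprod[OF mem[OF g]]
          unfolding reindex[OF f] reindex[OF g] by metis
      qed
    qed
    show "y \<in> A" if "y \<in> (\<lambda>f. \<Otimes>w\<in>v ` I. f w) ` (\<Pi>\<^sub>E w\<in>v ` I. E w)" for y
      using that reindex finprod_in[OF mem] by auto
    show "y \<in> (\<lambda>f. \<Otimes>w\<in>v ` I. f w) ` (\<Pi>\<^sub>E w\<in>v ` I. E w)" if y: "y \<in> A" for y
    proof -
      let ?f = "restrict (\<lambda>w. component (the_inv_into I v w) y) (v ` I)"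
      have f: "?f \<in> (\<Pi>\<^sub>E w\<in>v ` I. E w)"
        using component_in[OF y] E by (auto simp: the_inv_into_f_f[OF v])
      have "(\<Otimes>i\<in>I. ?f (v i)) = (\<Otimes>i\<in>I. component i y)"
        using component_carrier[OF y] by (intro finprod_cong') (auto simp: the_inv_into_f_f[OF v])
      then have "(\<Otimes>w\<in>v ` I. ?f w) = y" using reindex[OF f] finprod_component[OF y] by simp
      then show ?thesis using f by (intro image_eqI[of _ _ ?f]) auto
    qed
  qed
qed

text \<open>Distinct summands meet only in \<open>\<one>\<close>: a common element of
  \<open>F i\<close> and \<open>F j\<close> has both itself and \<open>\<one>\<close> as its
  \<open>i\<close>-th coordinate.\<close>

lemma inj_on_nontrivial_family:
  assumes "\<And>i. i \<in> I \<Longrightarrow> v i \<in> F i \<and> v i \<noteq> \<one>" shows "inj_on v I"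
proof (rule inj_onI, rule ccontr)
  fix i j assume ij: "i \<in> I" "j \<in> I" "v i = v j" "i \<noteq> j"
  have vi: "v i \<in> F i" "v i \<noteq> \<one>" using assms ij(1) by auto
  have vj: "v i \<in> F j" using assms[OF ij(2)] ij(3) by simp
  show False using component_summand[OF ij(1) vi(1) ij(1)] component_summand[OF ij(2) vj ij(1)]
      vi(2) ij(4) by simp
qed

end

locale torsion_free_direct_sum = torsion_free_group G + direct_sum G A I F
  for G (structure) and A I F
begin

text \<open>The coordinates of \<open>y\<close> off \<open>i\<close> are killed by \<open>n\<close>,
  so they are trivial by torsion-freeness. This is purity inside \<open>A\<close> only; purity in
  all of \<open>G\<close> will come from the minimality of an index.\<close>

lemma summand_pure:
  assumes "y \<in> A" "i \<in> I" "y [^] (n::int) \<in> F i" "n \<noteq> 0"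
  shows "y \<in> F i"
proof (rule in_summandI[OF assms(1,2)])
  fix j assume j: "j \<in> I" "j \<noteq> i"
  then have "component j y [^] n = \<one>"
    using assms component_summand[OF assms(2,3)] component_int_pow[OF assms(1)] by metis
  then show "component j y = \<one>"
    using int_pow_eq_one_iff component_carrier assms j by blast
qed

end

section \<open>Rank\<close>

locale tffr = torsion_free_group G for G (structure) +
  assumes finite_rank: "finite_rank G"
begin

text \<open>\<open>rk\<close> is a supremum of natural numbers, which is an upper bound only if the
  set is bounded; \<open>finite_rank\<close> provides the bound.\<close>

lemma card_le_rk:
  assumes "B \<subseteq> A" "Z_independent G B" shows "card B \<le> rk G A"
  unfolding rk_def
proof (rule cSup_upper)
  show "bdd_above {card B |B. B \<subseteq> A \<and> Z_independent G B}"
    using finite_rank unfolding finite_rank_def bdd_above_def by blast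
qed (use assms in blast)

lemma Z_independent_empty: "Z_independent G {}"
  by (simp add: Z_independent_def)

lemma rk_leI:
  assumes "\<And>B. B \<subseteq> A \<Longrightarrow> Z_independent G B \<Longrightarrow> card B \<le> n" shows "rk G A \<le> n"
  unfolding rk_def by (rule cSup_least) (use assms Z_independent_empty in blast)+

lemma Z_independent_singleton:
  assumes "x \<in> carrier G" shows "Z_independent G {x} \<longleftrightarrow> x \<noteq> \<one>"
proof -
  have "Z_independent G {x} \<longleftrightarrow> (\<forall>c :: 'a \<Rightarrow> int. x = \<one> \<longrightarrow> c x = 0)"
    using assms int_pow_eq_one_iff[OF assms] unfolding Z_independent_def by auto
  also have "\<dots> \<longleftrightarrow> x \<noteq> \<one>" by (auto dest: spec[of _ "\<lambda>_. 1"])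
  finally show ?thesis .
qed

lemma Z_independent_pairD:
  assumes "Z_independent G B" "x \<in> B" "y \<in> B" "x \<noteq> y" "x [^] (a::int) = y [^] (b::int)"
  shows "a = 0 \<and> b = 0"
proof -
  have B: "finite B" "B \<subseteq> carrier G" using assms unfolding Z_independent_def by auto
  \<comment> \<open>Coefficients of the relation
    \<open>x [^] a \<otimes> y [^] (- b) = \<one>\<close>, extended by zero to all of
    \<open>B\<close>.\<close>
  let ?c = "\<lambda>z. if z = x then a else if z = y then - b else 0"
  have "(\<Otimes>z\<in>B. z [^] ?c z) = (\<Otimes>z\<in>{x,y}. z [^] ?c z)"
    using B assms by (intro finprod_mono_neutral_cong_right) auto
  also have "\<dots> = x [^] a \<otimes> y [^] (- b)" using B assms by auto
  also have "\<dots> = \<one>" using assms B by (auto simp: int_pow_neg)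
  finally have "\<forall>z\<in>B. ?c z = 0"
    using assms(1) unfolding Z_independent_def by (elim conjE) (rule mp, erule spec)
  then show ?thesis using assms by auto
qed

lemma Z_independent_pairI:
  assumes "x \<in> carrier G" "y \<in> carrier G" "x \<noteq> y"
    and "\<And>(a::int) (b::int). x [^] a = y [^] b \<Longrightarrow> a = 0 \<and> b = 0"
  shows "Z_independent G {x, y}"
  unfolding Z_independent_def
proof (intro conjI allI impI)
  fix c :: "'a \<Rightarrow> int" assume "(\<Otimes>b\<in>{x,y}. b [^] c b) = \<one>"
  then have "x [^] c x \<otimes> y [^] c y = \<one>" using assms by simp
  then have "x [^] c x = y [^] (- c y)"
    using assms by (simp add: int_pow_neg) (metis inv_equality int_pow_closed inv_inv)
  from assms(4)[OF this] show "\<forall>b\<in>{x,y}. c b = 0" by simp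
qed (use assms in auto)

text \<open>Two distinct elements cannot be independent, and \<open>v \<noteq> \<one>\<close> keeps
  the exponent of \<open>y\<close> away from zero. Its sign is normalised because
  \<open>is_rat_multiple\<close> demands a positive denominator.\<close>

lemma rank_oneD:
  assumes "rk G A = 1" "A \<subseteq> carrier G"
  shows rank_one_nontrivial: "\<exists>x\<in>A. x \<noteq> \<one>"
    and rank_one_dependent:
      "\<lbrakk>v \<in> A; v \<noteq> \<one>; y \<in> A\<rbrakk> \<Longrightarrow> \<exists>(m::int) (n::int). 0 < n \<and> y [^] n = v [^] m"
proof -
  show "\<exists>x\<in>A. x \<noteq> \<one>"
  proof (rule ccontr)
    assume "\<not> (\<exists>x\<in>A. x \<noteq> \<one>)"
    then have A: "A \<subseteq> {\<one>}" by blast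
    have "rk G A \<le> 0"
    proof (rule rk_leI)
      fix B assume "B \<subseteq> A" "Z_independent G B"
      then have "B = {} \<or> B = {\<one>}" using A by blast
      then show "card B \<le> 0" using \<open>Z_independent G B\<close> Z_independent_singleton[of \<one>] by auto
    qed
    then show False using assms by simp
  qed
  assume v: "v \<in> A" "v \<noteq> \<one>" and y: "y \<in> A"
  have vy: "v \<in> carrier G" "y \<in> carrier G" using v y assms by auto
  show "\<exists>(m::int) (n::int). 0 < n \<and> y [^] n = v [^] m"
  proof (cases "y = v")
    case True then show ?thesis by (intro exI[of _ "1::int"]) simp
  next
    case False
    then have "\<not> Z_independent G {y, v}"
      using card_le_rk[of "{y, v}" A] v y assms by auto
    then obtain a b :: int where ab: "y [^] a = v [^] b" "\<not> (a = 0 \<and> b = 0)"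
      using Z_independent_pairI vy False by blast
    have "a \<noteq> 0" using ab vy v int_pow_eq_one_iff[of v b] by auto
    show ?thesis
    proof (cases "0 < a")
      case True then show ?thesis using ab by blast
    next
      case neg: False
      have "y [^] (- a) = v [^] (- b)" using ab vy by (simp add: int_pow_neg)
      moreover have "0 < - a" using neg \<open>a \<noteq> 0\<close> by simp
      ultimately show ?thesis by blast
    qed
  qed
qed

text \<open>The relation required of two elements may have one zero exponent, so pairs containing
  \<open>\<one>\<close> satisfy it too.\<close>

lemma rank_le_oneI:
  assumes "A \<subseteq> carrier G"
    and "\<And>x y. x \<in> A \<Longrightarrow> y \<in> A \<Longrightarrow> \<exists>(a::int) (b::int). (a \<noteq> 0 \<or> b \<noteq> 0) \<and> x [^] a = y [^] b"
  shows "rk G A \<le> 1"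
proof (rule rk_leI)
  fix B assume B: "B \<subseteq> A" "Z_independent G B"
  have "finite B" using B unfolding Z_independent_def by blast
  moreover have "x = y" if xy: "x \<in> B" "y \<in> B" for x y
  proof (rule ccontr)
    assume "x \<noteq> y"
    obtain a b :: int where "a \<noteq> 0 \<or> b \<noteq> 0" "x [^] a = y [^] b"
      using assms(2) B xy by blast
    then show False using Z_independent_pairD[OF B(2) xy \<open>x \<noteq> y\<close>] by blast
  qed
  ultimately show "card B \<le> 1" using card_le_Suc0_iff_eq[of B] by auto
qed

lemma rank_oneI:
  assumes "A \<subseteq> carrier G" "x \<in> A" "x \<noteq> \<one>"
    and "\<And>x y. x \<in> A \<Longrightarrow> y \<in> A \<Longrightarrow> \<exists>(a::int) (b::int). (a \<noteq> 0 \<or> b \<noteq> 0) \<and> x [^] a = y [^] b"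
  shows "rk G A = 1"
proof -
  have "1 \<le> rk G A" using card_le_rk[of "{x}" A] assms Z_independent_singleton[of x] by auto
  then show ?thesis using rank_le_oneI[OF assms(1,4)] by simp
qed

end

section \<open>Rank-one groups and their types\<close>

lemma group_rat_group: "group (rat_group UNIV)"
proof (rule groupI)
  fix x assume "x \<in> carrier (rat_group UNIV)"
  show "\<exists>y\<in>carrier (rat_group UNIV). y \<otimes>\<^bsub>rat_group UNIV\<^esub> x = \<one>\<^bsub>rat_group UNIV\<^esub>"
    by (rule bexI[of _ "- x"]) (simp_all add: rat_group_def)
qed (simp_all add: rat_group_def)

lemma inv_rat_group: "inv\<^bsub>rat_group UNIV\<^esub> q = - q"
proof -
  interpret Q: group "rat_group UNIV" by (rule group_rat_group)
  show ?thesis by (rule Q.inv_equality) (auto simp: rat_group_def)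
qed

context torsion_free_group
begin

text \<open>The same \<open>q\<close> may come from different fractions. Raising to the product of
  the two denominators makes the equations comparable, and torsion-freeness cancels the
  exponent.\<close>

lemma is_rat_multiple_unique:
  assumes "is_rat_multiple G q v y" "is_rat_multiple G q v y'"
    and v: "v \<in> carrier G" "y \<in> carrier G" "y' \<in> carrier G"
  shows "y = y'"
proof -
  obtain m n where mn: "0 < n" "q = of_int m / of_int n" "y [^] (n::int) = v [^] (m::int)"
    using assms unfolding is_rat_multiple_def by auto
  obtain m' n' where mn': "0 < n'" "q = of_int m' / of_int n'" "y' [^] (n'::int) = v [^] (m'::int)"
    using assms unfolding is_rat_multiple_def by auto
  have "(of_int (m * n') :: rat) = of_int (m' * n)" using mn mn' by (simp add: field_simps)
  then have eq: "m * n' = m' * n" by linarith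
  have "y [^] (n * n') = v [^] (m * n')" using mn v by (metis int_pow_pow)
  also have "\<dots> = (v [^] m') [^] n" using eq v by (simp add: int_pow_pow)
  also have "\<dots> = y' [^] (n * n')" using mn' v by (metis int_pow_pow mult.commute)
  finally show ?thesis using int_pow_cancel[of y y' "n * n'"] v mn mn' by auto
qed

lemma is_rat_multiple_coeff_unique:
  assumes "is_rat_multiple G q v y" "is_rat_multiple G q' v y"
    and v: "v \<in> carrier G" "y \<in> carrier G" "v \<noteq> \<one>"
  shows "q = q'"
proof -
  obtain m n where mn: "0 < n" "q = of_int m / of_int n" "y [^] (n::int) = v [^] (m::int)"
    using assms unfolding is_rat_multiple_def by auto
  obtain m' n' where mn': "0 < n'" "q' = of_int m' / of_int n'" "y [^] (n'::int) = v [^] (m'::int)"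
    using assms unfolding is_rat_multiple_def by auto
  have "v [^] (m * n') = y [^] (n * n')" using mn v by (metis int_pow_pow)
  also have "\<dots> = v [^] (m' * n)" using mn' v by (metis int_pow_pow mult.commute)
  finally have "v [^] (m * n' - m' * n) = \<one>" using v by (simp add: int_pow_diff)
  then have "m * n' = m' * n" using int_pow_eq_one_iff v by auto
  then have "(of_int m * of_int n' :: rat) = of_int m' * of_int n"
    by (metis of_int_mult)
  then show ?thesis using mn(1) mn'(1) unfolding mn(2) mn'(2) by (simp add: frac_eq_eq)
qed

lemma is_rat_multiple_add:
  assumes "is_rat_multiple G q v y" "is_rat_multiple G q' v y'"
    and v: "v \<in> carrier G" "y \<in> carrier G" "y' \<in> carrier G"
  shows "is_rat_multiple G (q + q') v (y \<otimes> y')"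
proof -
  obtain m n where mn: "0 < n" "q = of_int m / of_int n" "y [^] (n::int) = v [^] (m::int)"
    using assms unfolding is_rat_multiple_def by auto
  obtain m' n' where mn': "0 < n'" "q' = of_int m' / of_int n'" "y' [^] (n'::int) = v [^] (m'::int)"
    using assms unfolding is_rat_multiple_def by auto
  have "y [^] (n * n') = v [^] (m * n')" using mn v by (metis int_pow_pow)
  moreover have "y' [^] (n * n') = v [^] (m' * n)" using mn' v by (metis int_pow_pow mult.commute)
  ultimately have "(y \<otimes> y') [^] (n * n') = v [^] (m * n' + m' * n)"
    using v by (simp add: int_pow_distrib int_pow_mult)
  moreover have "q + q' = of_int (m * n' + m' * n) / of_int (n * n')" "0 < n * n'"
    using mn mn' by (simp_all add: field_simps)
  ultimately show ?thesis unfolding is_rat_multiple_def by blast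
qed

lemma is_rat_multiple_inv:
  assumes "is_rat_multiple G q v y" and v: "v \<in> carrier G" "y \<in> carrier G"
  shows "is_rat_multiple G (- q) v (inv y)"
proof -
  obtain m n where mn: "0 < n" "q = of_int m / of_int n" "y [^] (n::int) = v [^] (m::int)"
    using assms unfolding is_rat_multiple_def by auto
  then have "inv y [^] n = v [^] (- m)" "- q = of_int (- m) / of_int n"
    using v by (simp_all add: int_pow_inv int_pow_neg)
  then show ?thesis using mn(1) unfolding is_rat_multiple_def by blast
qed

lemma is_rat_multiple_one: "v \<in> carrier G \<Longrightarrow> is_rat_multiple G 1 v v"
  unfolding is_rat_multiple_def by (intro exI[of _ 1]) simp

section \<open>Rank-one groups as groups of rational coefficients\<close>

lemma rational_group_coeff_group:
  assumes A: "subgroup A G" and v: "v \<in> A"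
  shows "rational_group (coeff_group G A v)"
proof -
  interpret Q: group "rat_group UNIV" by (rule group_rat_group)
  interpret A: subgroup A G by (rule A)
  have vc: "v \<in> carrier G" using v by (rule A.mem_carrier)
  have "subgroup (coeff_group G A v) (rat_group UNIV)"
  proof (rule Q.subgroupI)
    show "coeff_group G A v \<noteq> {}"
      using is_rat_multiple_one[OF vc] v unfolding coeff_group_def by blast
    show "inv\<^bsub>rat_group UNIV\<^esub> a \<in> coeff_group G A v" if a: "a \<in> coeff_group G A v" for a
    proof -
      obtain y where y: "y \<in> A" "is_rat_multiple G a v y"
        using a unfolding coeff_group_def by auto
      then have "is_rat_multiple G (- a) v (inv y)" "inv y \<in> A"
        using is_rat_multiple_inv[OF y(2) vc] by auto
      then show ?thesis unfolding inv_rat_group coeff_group_def by auto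
    qed
    show "a \<otimes>\<^bsub>rat_group UNIV\<^esub> b \<in> coeff_group G A v"
      if a: "a \<in> coeff_group G A v" and b: "b \<in> coeff_group G A v" for a b
    proof -
      obtain y where y: "y \<in> A" "is_rat_multiple G a v y"
        using a unfolding coeff_group_def by auto
      obtain z where z: "z \<in> A" "is_rat_multiple G b v z"
        using b unfolding coeff_group_def by auto
      have "is_rat_multiple G (a + b) v (y \<otimes> z)" "y \<otimes> z \<in> A"
        using is_rat_multiple_add[OF y(2) z(2) vc] y z by auto
      then show ?thesis unfolding coeff_group_def rat_group_def by auto
    qed
  qed (simp add: rat_group_def)
  moreover have "1 \<in> coeff_group G A v"
    using is_rat_multiple_one[OF vc] v unfolding coeff_group_def by blast
  ultimately show ?thesis unfolding rational_group_def by blast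
qed

end

context tffr
begin

lemma rank_one_rat_multiple:
  assumes "rk G A = 1" "A \<subseteq> carrier G" "v \<in> A" "v \<noteq> \<one>" "y \<in> A"
  shows "\<exists>q. is_rat_multiple G q v y"
  using rank_one_dependent[OF assms] unfolding is_rat_multiple_def by blast

text \<open>The isomorphism sends \<open>q\<close> to \<open>q v\<close>: rank one makes it
  surjective, torsion-freeness single-valued, and \<open>v \<noteq> \<one>\<close> injective. In
  particular, the type of a rank-one subgroup has a representative.\<close>

lemma coeff_group_in_type_of:
  assumes "rk G A = 1" and A: "subgroup A G" and v: "v \<in> A" "v \<noteq> \<one>"
  shows "coeff_group G A v \<in> type_of G A"
proof -
  interpret A: subgroup A G by (rule A)
  have vc: "v \<in> carrier G" using v(1) by (rule A.mem_carrier)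
  let ?S = "coeff_group G A v"
  define h where "h = (\<lambda>q. THE y. y \<in> A \<and> is_rat_multiple G q v y)"
  have h_eq: "h q = y" if "y \<in> A" "is_rat_multiple G q v y" for q y
    unfolding h_def
  proof (rule the_equality)
    show "z = y" if "z \<in> A \<and> is_rat_multiple G q v z" for z
      using is_rat_multiple_unique[of q v z y] that \<open>y \<in> A\<close>
        \<open>is_rat_multiple G q v y\<close> vc A.mem_carrier by simp
  qed (use that in simp)
  have h: "h q \<in> A" "is_rat_multiple G q v (h q)" if q: "q \<in> ?S" for q
  proof -
    obtain y where "y \<in> A" "is_rat_multiple G q v y"
      using q unfolding coeff_group_def by auto
    then show "h q \<in> A" "is_rat_multiple G q v (h q)" using h_eq by auto
  qed
  have "h \<in> iso (rat_group ?S) (G\<lparr>carrier := A\<rparr>)"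
  proof (rule isoI)
    show "h \<in> hom (rat_group ?S) (G\<lparr>carrier := A\<rparr>)"
    proof (rule homI)
      fix p q assume "p \<in> carrier (rat_group ?S)" "q \<in> carrier (rat_group ?S)"
      then have pq: "p \<in> ?S" "q \<in> ?S" by (simp_all add: rat_group_def)
      have "h (p + q) = h p \<otimes> h q"
        using is_rat_multiple_add[OF h(2)[OF pq(1)] h(2)[OF pq(2)] vc] h(1) pq
        by (intro h_eq) auto
      then show "h (p \<otimes>\<^bsub>rat_group ?S\<^esub> q) = h p \<otimes>\<^bsub>G\<lparr>carrier := A\<rparr>\<^esub> h q"
        by (simp add: rat_group_def)
    qed (auto simp: rat_group_def h)
    have "inj_on h ?S"
    proof (rule inj_onI)
      fix p q assume pq: "p \<in> ?S" "q \<in> ?S" "h p = h q"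
      then show "p = q"
        using is_rat_multiple_coeff_unique[OF h(2)[OF pq(1)] _ vc _ v(2)]
          h(1)[OF pq(1)] h(2)[OF pq(2)] A.mem_carrier by simp
    qed
    moreover have "h ` ?S = A"
    proof
      show "A \<subseteq> h ` ?S"
      proof
        fix y assume y: "y \<in> A"
        obtain q where q: "is_rat_multiple G q v y"
          using rank_one_rat_multiple[OF assms(1) A.subset v y] by blast
        then have "q \<in> ?S" using y unfolding coeff_group_def by blast
        then show "y \<in> h ` ?S" using h_eq[OF y q] by blast
      qed
    qed (use h in blast)
    ultimately show "bij_betw h (carrier (rat_group ?S)) (carrier (G\<lparr>carrier := A\<rparr>))"
      by (simp add: bij_betw_def rat_group_def)
  qed
  then show ?thesis using rational_group_coeff_group[OF A v(1)]
    unfolding type_of_def is_iso_def by blast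
qed

text \<open>\<open>type_le\<close> speaks of maps between rational groups, so \<open>h\<close> is
  conjugated by isomorphisms with representatives of the two types. These exist because rank-one
  groups contain nontrivial elements.\<close>

lemma type_leI:
  assumes A: "rk G A = 1" "subgroup A G" and B: "rk G B = 1" "subgroup B G"
    and h: "h \<in> hom (G\<lparr>carrier := A\<rparr>) (G\<lparr>carrier := B\<rparr>)" and x: "x \<in> A" "h x \<noteq> \<one>"
  shows "type_le (type_of G A) (type_of G B)"
proof -
  obtain a where "a \<in> A" "a \<noteq> \<one>"
    using rank_one_nontrivial[OF A(1) subgroup.subset[OF A(2)]] by auto
  then obtain S where S: "S \<in> type_of G A" using coeff_group_in_type_of[OF A] by auto
  obtain b where "b \<in> B" "b \<noteq> \<one>"
    using rank_one_nontrivial[OF B(1) subgroup.subset[OF B(2)]] by auto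
  then obtain T where T: "T \<in> type_of G B" using coeff_group_in_type_of[OF B] by auto
  obtain f where f: "f \<in> iso (rat_group S) (G\<lparr>carrier := A\<rparr>)"
    using S unfolding type_of_def is_iso_def by auto
  obtain g where g: "g \<in> iso (rat_group T) (G\<lparr>carrier := B\<rparr>)"
    using T unfolding type_of_def is_iso_def by auto
  have "subgroup T (rat_group UNIV)" using T unfolding type_of_def rational_group_def by blast
  then have "group ((rat_group UNIV)\<lparr>carrier := T\<rparr>)"
    using group.subgroup_imp_group[OF group_rat_group] by blast
  then have TG: "group (rat_group T)" by (simp add: rat_group_def)
  have BG: "group (G\<lparr>carrier := B\<rparr>)" using B subgroup_imp_group by blast
  let ?g = "inv_into (carrier (rat_group T)) g"
  have g': "?g \<in> iso (G\<lparr>carrier := B\<rparr>) (rat_group T)" using group.iso_set_sym[OF TG g] .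
  let ?k = "?g \<circ> (h \<circ> f)"
  have k: "?k \<in> hom (rat_group S) (rat_group T)"
    by (rule Group.hom_compose[OF Group.hom_compose[OF iso_imp_homomorphism[OF f] h]
        iso_imp_homomorphism[OF g']])
  obtain s where s: "s \<in> S" "f s = x"
    using f x(1) unfolding iso_def bij_betw_def by (auto simp: rat_group_def)
  have "?g (h x) \<noteq> 0"
  proof
    assume "?g (h x) = 0"
    moreover have "?g \<one> = 0" using hom_one[OF iso_imp_homomorphism[OF g'] BG TG]
      by (simp add: rat_group_def)
    moreover have "inj_on ?g B" using g' unfolding iso_def bij_betw_def by simp
    moreover have "h x \<in> B" using h x by (auto simp: hom_def)
    moreover have "\<one> \<in> B" using B subgroup.one_closed by blast
    ultimately show False using x(2) by (metis inj_onD)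
  qed
  then have "?k s \<noteq> 0" using s by simp
  then show ?thesis unfolding type_le_def
    by (intro bexI[OF _ S] bexI[OF _ T] bexI[OF _ k] bexI[OF _ s(1)])
qed

text \<open>There must be exactly one summand: without any, \<open>A\<close> would be trivial, and
  two nontrivial summands would contradict the dependence of their elements.\<close>

lemma homogeneous_rank_one:
  assumes "homogeneous G \<rho> A" "rk G A = 1"
  shows "type_of G A = \<rho>"
proof -
  obtain n :: nat and F where F: "direct_decomp G A {..<n} F"
    and rk1: "\<And>i. i < n \<Longrightarrow> rk G (F i) = 1" and type: "\<And>i. i < n \<Longrightarrow> type_of G (F i) = \<rho>"
    using assms(1) unfolding homogeneous_def by blast
  interpret A: torsion_free_direct_sum G A "{..<n}" F by unfold_locales (rule F)
  have Ac: "A \<subseteq> carrier G" using A.sum_subgroup subgroup.subset by blast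
  have "n \<noteq> 0"
  proof
    assume "n = 0"
    then have "A \<subseteq> {\<one>}" using A.component_eqI A.one_in by auto
    then show False using rank_one_nontrivial[OF assms(2) Ac] by blast
  qed
  then have n0: "0 \<in> {..<n}" by simp
  obtain x where x: "x \<in> F 0" "x \<noteq> \<one>"
    using rank_one_nontrivial[OF rk1 A.summand_carrier[OF n0]] n0 by auto
  have "n = 1"
  proof (rule ccontr)
    assume "n \<noteq> 1"
    then have n1: "1 \<in> {..<n}" using \<open>n \<noteq> 0\<close> by simp
    obtain y where y: "y \<in> F 1" "y \<noteq> \<one>"
      using rank_one_nontrivial[OF rk1 A.summand_carrier[OF n1]] n1 by auto
    obtain a b :: int where ab: "0 < a" "y [^] a = x [^] b"
      using rank_one_dependent[OF assms(2) Ac, of x y] A.summand_in[OF n0 x(1)]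
        A.summand_in[OF n1 y(1)] x by blast
    have "y [^] a \<in> F 0"
      using ab x subgroup_int_pow_closed[OF A.summand_subgroup[OF n0]] by simp
    \<comment> \<open>A nonzero multiple of \<open>y\<close> lies in \<open>F 0\<close>, and
      summands are pure, so \<open>y\<close> would lie in two summands at once.\<close>
    then have "y \<in> F 0" using A.summand_pure[OF A.summand_in[OF n1 y(1)] n0] ab(1) by blast
    then show False
      using A.component_summand[OF n0, of y 1] A.component_summand[OF n1 y(1) n1] n1 y by simp
  qed
  have "A = F 0"
    using A.in_summandI[OF _ n0] A.summand_in[OF n0] \<open>n = 1\<close> by auto
  then show ?thesis using type[of 0] n0 by simp
qed

end

section \<open>Orders modulo a subgroup and modulo multiples\<close>

context comm_group
begin

lemma FactGroup_pow_eq_one_iff: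
  assumes H: "subgroup H G" and x: "x \<in> carrier G"
  shows "(H #> x) [^]\<^bsub>G Mod H\<^esub> (k::nat) = \<one>\<^bsub>G Mod H\<^esub> \<longleftrightarrow> x [^] k \<in> H"
proof -
  have "H #> (x [^] k) = H \<longleftrightarrow> x [^] k \<in> H"
    using coset_join1[OF _ _ H] coset_join2[OF _ H] x by blast
  then show ?thesis
    using normal.FactGroup_pow[OF subgroup_imp_normal[OF H] x] by simp
qed

lemma FactGroup_ord_dvd_iff:
  assumes H: "subgroup H G" and x: "x \<in> carrier G"
  shows "group.ord (G Mod H) (H #> x) dvd k \<longleftrightarrow> x [^] k \<in> H"
proof -
  interpret Q: group "G Mod H" using abelian_FactGroup[OF H] comm_group.axioms(2) by blast
  have "H #> x \<in> carrier (G Mod H)" using x by (auto simp: carrier_FactGroup)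
  then show ?thesis
    using Q.pow_eq_id FactGroup_pow_eq_one_iff[OF H x] by simp
qed

section \<open>Orders modulo multiples\<close>

lemma pow_image_subgroup:
  assumes A: "subgroup A G"
  shows "subgroup ((\<lambda>x. x [^] (e::nat)) ` A) G"
proof -
  interpret A: subgroup A G by (rule A)
  show ?thesis
  proof (rule subgroupI)
    show "(\<lambda>x. x [^] e) ` A \<subseteq> carrier G" using A.mem_carrier by auto
    show "(\<lambda>x. x [^] e) ` A \<noteq> {}" using A.one_closed by blast
    show "inv a \<in> (\<lambda>x. x [^] e) ` A" if a: "a \<in> (\<lambda>x. x [^] e) ` A" for a
    proof -
      obtain c where "c \<in> A" "a = c [^] e" using a by auto
      then have "inv a = inv c [^] e" "inv c \<in> A" by (auto simp: nat_pow_inv)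
      then show ?thesis by blast
    qed
    show "a \<otimes> b \<in> (\<lambda>x. x [^] e) ` A"
      if ab: "a \<in> (\<lambda>x. x [^] e) ` A" "b \<in> (\<lambda>x. x [^] e) ` A" for a b
    proof -
      obtain c d where "c \<in> A" "d \<in> A" "a = c [^] e" "b = d [^] e" using ab by auto
      then have "a \<otimes> b = (c \<otimes> d) [^] e" "c \<otimes> d \<in> A" by (auto simp: nat_pow_distrib)
      then show ?thesis by blast
    qed
  qed
qed

text \<open>Later arguments about orders go through this criterion: an order is determined by the
  numbers it divides, so the cosets in \<open>A/eA\<close> can be forgotten.\<close>

lemma ord_mod_dvd_iff:
  assumes A: "subgroup A G" and a: "a \<in> A"
  shows "ord_mod G A e a dvd k \<longleftrightarrow> (\<exists>r\<in>A. a [^] k = r [^] e)"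
proof -
  let ?H = "G\<lparr>carrier := A\<rparr>" and ?eA = "(\<lambda>x. x [^] e) ` A"
  interpret H: comm_group ?H
  proof (rule group.group_comm_groupI)
    show "group ?H" using A by (rule subgroup_imp_group)
    show "x \<otimes>\<^bsub>?H\<^esub> y = y \<otimes>\<^bsub>?H\<^esub> x" if "x \<in> carrier ?H" "y \<in> carrier ?H" for x y
      using that subgroup.mem_carrier[OF A] by (simp add: m_comm)
  qed
  have "subgroup ?eA ?H"
    using H.pow_image_subgroup[OF H.subgroup_self, of e] by (simp add: nat_pow_consistent[symmetric])
  moreover have "?eA #>\<^bsub>G\<^esub> a = ?eA #>\<^bsub>?H\<^esub> a" by (simp add: r_coset_def)
  ultimately show ?thesis
    using H.FactGroup_ord_dvd_iff[of ?eA a k] a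
    unfolding ord_mod_def Let_def by (auto simp: nat_pow_consistent[symmetric])
qed

lemma ord_mod_dvd:
  assumes "subgroup A G" "a \<in> A" shows "ord_mod G A e a dvd e"
  using ord_mod_dvd_iff[OF assms] assms by blast

section \<open>Index and cyclic quotients\<close>

lemma pow_index_in:
  assumes H: "subgroup H G" and x: "x \<in> carrier G"
  shows "x [^] card (rcosets H) \<in> H"
proof -
  interpret Q: group "G Mod H" using abelian_FactGroup[OF H] comm_group.axioms(2) by blast
  have "H #> x \<in> carrier (G Mod H)" using x by (auto simp: carrier_FactGroup)
  \<comment> \<open>Lagrange's theorem in the quotient; if the index is infinite, the exponent is
    \<open>0\<close>.\<close>
  then have "(H #> x) [^]\<^bsub>G Mod H\<^esub> order (G Mod H) = \<one>\<^bsub>G Mod H\<^esub>"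
    by (rule Q.pow_order_eq_1)
  then show ?thesis
    using FactGroup_pow_eq_one_iff[OF H x] by (simp add: order_def FactGroup_def)
qed

text \<open>Any preimage \<open>x\<close> of a generator of the quotient works. The order of that
  generator is the index, which identifies the exponents that carry \<open>x\<close> into
  \<open>H\<close>.\<close>

lemma cyclic_quotient_generator:
  assumes H: "subgroup H G" and cyclic: "cyclic_group (G Mod H)"
  shows "\<exists>x\<in>carrier G. carrier G = H <#> range (\<lambda>k::int. x [^] k) \<and>
    (\<forall>k. x [^] k \<in> H \<longleftrightarrow> card (rcosets H) dvd k)"
proof -
  interpret Q: group "G Mod H" using abelian_FactGroup[OF H] comm_group.axioms(2) by blast
  interpret N: normal H G using subgroup_imp_normal[OF H] .
  obtain C where C: "C \<in> carrier (G Mod H)"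
    and gen: "carrier (G Mod H) = range (\<lambda>n::int. C [^]\<^bsub>G Mod H\<^esub> n)"
    using cyclic Q.cyclic_group by auto
  obtain x where x: "x \<in> carrier G" "C = H #> x" using C by (auto simp: carrier_FactGroup)
  have "carrier G \<subseteq> H <#> range (\<lambda>k::int. x [^] k)"
  proof
    fix y assume y: "y \<in> carrier G"
    then have "H #> y \<in> carrier (G Mod H)" by (auto simp: carrier_FactGroup)
    then obtain n :: int where "H #> y = H #> (x [^] n)"
      using gen N.FactGroup_int_pow[OF x(1)] x(2) by auto
    then have "y \<in> H #> (x [^] n)" using rcos_self[OF y H] by simp
    then show "y \<in> H <#> range (\<lambda>k::int. x [^] k)"
      unfolding r_coset_def set_mult_def by auto
  qed
  moreover have "H <#> range (\<lambda>k::int. x [^] k) \<subseteq> carrier G"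
    using x(1) by (intro set_mult_closed) auto
  moreover have "group.ord (G Mod H) C = card (rcosets H)"
  proof -
    have "carrier (G Mod H) = generate (G Mod H) {C}"
      using gen Q.generate_pow[OF C] by auto
    then show ?thesis using Q.generate_pow_card[OF C] by (simp add: FactGroup_def)
  qed
  ultimately show ?thesis using FactGroup_ord_dvd_iff[OF H x(1)] x by auto
qed

end

section \<open>Regulating subgroups\<close>

context tffr
begin

text \<open>Replacing \<open>F i\<close> by its purification in \<open>G\<close> enlarges
  \<open>W\<close> to another completely decomposable subgroup of finite index. As \<open>W\<close>
  has least index, elements of the purification already lie in \<open>W\<close>, where summands are
  pure.\<close>

lemma regulating_summand_pure:
  fixes n :: nat
  assumes W: "regulating G W" and F: "direct_decomp G W {..<n} F"
    and rk1: "\<And>j. j < n \<Longrightarrow> rk G (F j) = 1"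
    and i: "i < n" and y: "y \<in> carrier G" "y [^] (N::int) \<in> F i" "N \<noteq> 0"
  shows "y \<in> F i"
proof -
  interpret W: torsion_free_direct_sum G W "{..<n}" F by unfold_locales (rule F)
  have i': "i \<in> {..<n}" using i by simp
  \<comment> \<open>The purification of \<open>F i\<close> in \<open>G\<close>, which again has rank
    one.\<close>
  define P where "P = {z \<in> carrier G. \<exists>k::int. k \<noteq> 0 \<and> z [^] k \<in> F i}"
  have PI: "z \<in> P" if "z \<in> carrier G" "z [^] k \<in> F i" "k \<noteq> 0" for z and k :: int
    using that unfolding P_def by blast
  have PE: "\<exists>k::int. k \<noteq> 0 \<and> z [^] k \<in> F i" "z \<in> carrier G" if "z \<in> P" for z
    using that unfolding P_def by auto
  have Fi: "subgroup (F i) G" using W.summand_subgroup[OF i'] .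
  have Fi_pow: "z [^] (k * l) \<in> F i" if "z \<in> carrier G" "z [^] k \<in> F i" for z and k l :: int
    using subgroup_int_pow_closed[OF Fi that(2), of l] that(1) by (simp add: int_pow_pow)
  have FP: "F i \<subseteq> P"
    using PI[of _ 1] W.summand_carrier[OF i'] by auto
  have P: "subgroup P G"
  proof (rule subgroupI)
    show "P \<subseteq> carrier G" using PE by blast
    show "P \<noteq> {}" using FP subgroup.one_closed[OF Fi] by blast
    show "inv a \<in> P" if a: "a \<in> P" for a
    proof -
      obtain k :: int where k: "k \<noteq> 0" "a [^] k \<in> F i" using PE a by blast
      have "inv a [^] k = inv (a [^] k)" using int_pow_inv PE(2)[OF a] by blast
      then show ?thesis
        using PI[of "inv a" k] k PE(2)[OF a] subgroup.m_inv_closed[OF Fi k(2)] by simp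
    qed
    show "a \<otimes> b \<in> P" if a: "a \<in> P" and b: "b \<in> P" for a b
    proof -
      obtain k :: int where k: "k \<noteq> 0" "a [^] k \<in> F i" using PE a by blast
      obtain l :: int where l: "l \<noteq> 0" "b [^] l \<in> F i" using PE b by blast
      have "a [^] (k * l) \<otimes> b [^] (l * k) \<in> F i"
        using Fi_pow k l PE(2) a b subgroup.m_closed[OF Fi] by blast
      then have "(a \<otimes> b) [^] (k * l) \<in> F i"
        using PE(2) a b by (simp add: int_pow_distrib mult.commute)
      then show ?thesis using PI[of "a \<otimes> b" "k * l"] k l PE(2) a b by simp
    qed
  qed
  have rkP: "rk G P = 1"
  proof -
    obtain x where x: "x \<in> F i" "x \<noteq> \<one>"
      using rank_one_nontrivial[OF rk1[OF i] W.summand_carrier[OF i']] by auto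
    show ?thesis
    proof (rule rank_oneI[of P x])
      fix u w assume u: "u \<in> P" and w: "w \<in> P"
      obtain k :: int where k: "k \<noteq> 0" "u [^] k \<in> F i" using PE u by blast
      obtain l :: int where l: "l \<noteq> 0" "w [^] l \<in> F i" using PE w by blast
      show "\<exists>(a::int) (b::int). (a \<noteq> 0 \<or> b \<noteq> 0) \<and> u [^] a = w [^] b"
      proof (cases "u [^] k = \<one>")
        case True
        then show ?thesis using k by (intro exI[of _ k] exI[of _ "0::int"]) simp
      next
        case False
        obtain c d :: int where "0 < d" "(w [^] l) [^] d = (u [^] k) [^] c"
          using rank_one_dependent[OF rk1[OF i] W.summand_carrier[OF i'] k(2) False l(2)] by auto
        then have "u [^] (k * c) = w [^] (l * d)" "l * d \<noteq> 0"
          using u w PE(2) l by (simp_all add: int_pow_pow)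
        then show ?thesis by blast
      qed
    qed (use PE x FP in auto)
  qed
  define F' where "F' = F(i := P)"
  have FF': "F j \<subseteq> F' j" for j using FP by (simp add: F'_def)
  have F'c: "F' j \<subseteq> carrier G" if "j < n" for j
    using PE(2) W.summand_carrier that by (auto simp: F'_def)
  define W' where "W' = (\<lambda>f. \<Otimes>j\<in>{..<n}. f j) ` (\<Pi>\<^sub>E j\<in>{..<n}. F' j)"
  \<comment> \<open>One exponent suffices because only the summand at \<open>i\<close> has been
    enlarged. It carries a family back to the summands of \<open>W\<close>, where coordinates are
    unique; hence the enlarged sum is still direct.\<close>
  have F'k: "\<exists>k::int. k \<noteq> 0 \<and> (\<forall>j<n. f j [^] k \<in> F j)" if f: "f \<in> (\<Pi>\<^sub>E j\<in>{..<n}. F' j)" for f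
  proof -
    have "f i \<in> P" using PiE_mem[OF f, of i] i by (simp add: F'_def)
    then obtain k :: int where k: "k \<noteq> 0" "f i [^] k \<in> F i" using PE by blast
    have "f j [^] k \<in> F j" if "j < n" for j
    proof (cases "j = i")
      case False
      then have "f j \<in> F j" using PiE_mem[OF f, of j] that by (simp add: F'_def)
      then show ?thesis using subgroup_int_pow_closed[OF W.summand_subgroup] that by simp
    qed (use k in simp)
    then show ?thesis using k by blast
  qed
  have inj: "inj_on (\<lambda>f. \<Otimes>j\<in>{..<n}. f j) (\<Pi>\<^sub>E j\<in>{..<n}. F' j)"
  proof (rule inj_onI)
    fix f g assume f: "f \<in> (\<Pi>\<^sub>E j\<in>{..<n}. F' j)" and g: "g \<in> (\<Pi>\<^sub>E j\<in>{..<n}. F' j)"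
      and eq: "(\<Otimes>j\<in>{..<n}. f j) = (\<Otimes>j\<in>{..<n}. g j)"
    obtain k :: int where k: "k \<noteq> 0" "\<And>j. j < n \<Longrightarrow> f j [^] k \<in> F j" using F'k[OF f] by blast
    obtain l :: int where l: "l \<noteq> 0" "\<And>j. j < n \<Longrightarrow> g j [^] l \<in> F j" using F'k[OF g] by blast
    have fc: "f \<in> {..<n} \<rightarrow> carrier G" and gc: "g \<in> {..<n} \<rightarrow> carrier G"
      using PiE_mem[OF f] PiE_mem[OF g] F'c by blast+
    have fk: "(\<lambda>j. f j [^] (k * l)) \<in> Pi {..<n} F"
    proof
      fix j assume j: "j \<in> {..<n}"
      have "(f j [^] k) [^] l \<in> F j"
        using subgroup_int_pow_closed[OF W.summand_subgroup[OF j]] k j by simp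
      then show "f j [^] (k * l) \<in> F j" using fc j by (auto simp: int_pow_pow Pi_iff)
    qed
    have gk: "(\<lambda>j. g j [^] (k * l)) \<in> Pi {..<n} F"
    proof
      fix j assume j: "j \<in> {..<n}"
      have "(g j [^] l) [^] k \<in> F j"
        using subgroup_int_pow_closed[OF W.summand_subgroup[OF j]] l j by simp
      then show "g j [^] (k * l) \<in> F j" using gc j by (auto simp: int_pow_pow Pi_iff mult.commute)
    qed
    have eq': "(\<Otimes>j\<in>{..<n}. f j [^] (k * l)) = (\<Otimes>j\<in>{..<n}. g j [^] (k * l))"
      using finprod_pow[OF fc] finprod_pow[OF gc] eq by simp
    show "f = g"
    proof (rule PiE_ext[OF f g])
      fix j assume j: "j \<in> {..<n}"
      have "f j [^] (k * l) = g j [^] (k * l)"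
        using W.component_finprod[OF fk j] W.component_finprod[OF gk j] eq' by simp
      then show "f j = g j" using int_pow_cancel[of "f j" "g j" "k * l"] fc gc j k l by auto
    qed
  qed
  have "\<forall>j\<in>{..<n}. subgroup (F' j) G" using W.summand_subgroup P by (simp add: F'_def)
  then have dd: "direct_decomp G W' {..<n} F'"
    unfolding direct_decomp_def using inj by (simp add: W'_def bij_betw_def)
  interpret W': direct_sum G W' "{..<n}" F' by unfold_locales (rule dd)
  have WW': "W \<subseteq> W'"
  proof
    fix w assume w: "w \<in> W"
    have "(\<lambda>j. W.component j w) \<in> Pi {..<n} F'" using W.component_in[OF w] FF' by blast
    then show "w \<in> W'" using W'.finprod_in W.finprod_component[OF w] by metis
  qed
  \<comment> \<open>Sends a coset of \<open>W\<close> to the coset of \<open>W'\<close> containing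
    it. The map is onto, so finiteness and the minimal index of \<open>W\<close> force it to be
    injective.\<close>
  let ?\<phi> = "\<lambda>C. W' <#> C"
  have \<phi>: "W' <#> (W #> x) = W' #> x" if x: "x \<in> carrier G" for x
  proof
    show "W' <#> (W #> x) \<subseteq> W' #> x"
    proof
      fix z assume "z \<in> W' <#> (W #> x)"
      then obtain a b where ab: "a \<in> W'" "b \<in> W" "z = a \<otimes> (b \<otimes> x)"
        unfolding set_mult_def r_coset_def by auto
      then have "z = (a \<otimes> b) \<otimes> x" "a \<otimes> b \<in> W'"
        using x WW' W'.mult_in W'.in_carrier W.in_carrier by (auto simp: m_assoc)
      then show "z \<in> W' #> x" unfolding r_coset_def by blast
    qed
    show "W' #> x \<subseteq> W' <#> (W #> x)"
    proof
      fix z assume "z \<in> W' #> x"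
      then obtain a where a: "a \<in> W'" "z = a \<otimes> x" unfolding r_coset_def by auto
      have "x \<in> W #> x" using rcos_self[OF x W.sum_subgroup] .
      then show "z \<in> W' <#> (W #> x)" unfolding set_mult_def using a by blast
    qed
  qed
  have img: "rcosets W' = ?\<phi> ` (rcosets W)"
    unfolding RCOSETS_def using \<phi> by auto
  have finW: "finite (rcosets W)" using W unfolding regulating_def finite_index_cd_def by blast
  have "finite_index_cd G W'"
    unfolding finite_index_cd_def completely_decomposable_def
  proof (intro conjI exI)
    show "direct_decomp G W' {..<n} F'" by (rule dd)
    show "\<forall>j<n. rk G (F' j) = 1" using rk1 rkP by (simp add: F'_def)
    show "finite (rcosets W')" using finW img by simp
  qed (rule W'.sum_subgroup)
  then have "card (rcosets W) \<le> card (?\<phi> ` (rcosets W))"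
    using W img unfolding regulating_def by auto
  then have inj\<phi>: "inj_on ?\<phi> (rcosets W)"
    using finW card_image_le[OF finW, of ?\<phi>] by (intro eq_card_imp_inj_on) auto
  have yW': "y \<in> W'"
    using W'.summand_in[OF i', of y] PI[OF y] by (simp add: F'_def)
  \<comment> \<open>Both cosets are sent to \<open>W'\<close>, since
    \<open>y \<in> W'\<close>.\<close>
  have "W #> y = W #> \<one>"
  proof (rule inj_onD[OF inj\<phi>])
    have "W' #> y = W'" "W' #> \<one> = W'"
      using coset_join2 W'.sum_subgroup yW' y W'.one_in by auto
    then show "W' <#> (W #> y) = W' <#> (W #> \<one>)" using \<phi> y by simp
  qed (use y W.in_carrier rcosetsI in auto)
  then have "W #> y = W" using coset_join2[OF _ W.sum_subgroup W.one_in] by simp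
  then have "y \<in> W" using coset_join1[OF _ y(1) W.sum_subgroup] by simp
  then show ?thesis using W.summand_pure[OF _ i' y(2,3)] by simp
qed

section \<open>Existence and common index of regulating subgroups\<close>

lemma ex_regulating:
  assumes "almost_completely_decomposable G" shows "\<exists>W. regulating G W"
proof -
  obtain W where "finite_index_cd G W"
    using assms unfolding almost_completely_decomposable_def by blast
  then show ?thesis unfolding regulating_def
    using ex_has_least_nat[of "finite_index_cd G" W "\<lambda>W. card (rcosets W)"] by blast
qed

lemma regulating_subgroup: "regulating G W \<Longrightarrow> subgroup W G"
  unfolding regulating_def finite_index_cd_def by blast

text \<open>By mutual minimality all regulating subgroups have the same index. This one number
  multiplies every element into each of them, hence into their intersection.\<close>

lemma regulator_exponent:
  assumes "almost_completely_decomposable G"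
  shows "\<exists>n::nat. 0 < n \<and> (\<forall>x\<in>carrier G. x [^] n \<in> regulator G)"
proof -
  obtain W where W: "regulating G W" using ex_regulating[OF assms] by blast
  let ?n = "card (rcosets W)"
  have "x [^] ?n \<in> W'" if W': "regulating G W'" and x: "x \<in> carrier G" for x W'
  proof -
    have "card (rcosets W') = ?n"
      using W W' unfolding regulating_def by (meson le_antisym)
    then show ?thesis using pow_index_in[OF regulating_subgroup[OF W'] x] by simp
  qed
  moreover have "finite (rcosets W)" "rcosets W \<noteq> {}"
    using W subgroup.rcosets_non_empty
    unfolding regulating_def finite_index_cd_def by (auto simp: RCOSETS_def)
  then have "0 < ?n" by (simp add: card_gt_0_iff)
  ultimately show ?thesis unfolding regulator_def by (intro exI[of _ ?n]) auto
qed

end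

section \<open>Rigid groups with an antichain of types\<close>

text \<open>\<open>R\<close> is kept abstract; the lemmas that concern the regulator assume
  \<open>R = regulator G\<close>. The summands are indexed by their types, so the antichain
  condition compares indices directly.\<close>

locale rigid_decomposition =
  tffr G + torsion_free_direct_sum G R T F
  for G (structure) and R and T :: "rtype set" and F +
  assumes rank_one: "\<And>\<rho>. \<rho> \<in> T \<Longrightarrow> rk G (F \<rho>) = 1"
    and summand_type: "\<And>\<rho>. \<rho> \<in> T \<Longrightarrow> type_of G (F \<rho>) = \<rho>"
    and antichain: "\<And>\<sigma> \<tau>. \<lbrakk>\<sigma> \<in> T; \<tau> \<in> T; type_le \<sigma> \<tau>\<rbrakk> \<Longrightarrow> \<sigma> = \<tau>"
begin

lemma pow_in: "y \<in> R \<Longrightarrow> y [^] (k::nat) \<in> R"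
  and component_pow: "y \<in> R \<Longrightarrow> \<tau> \<in> T \<Longrightarrow> component \<tau> (y [^] (k::nat)) = component \<tau> y [^] k"
  using int_pow_in[of y "int k"] component_int_pow[of y \<tau> "int k"] by (simp_all add: int_pow_int)

text \<open>A nontrivial value would give \<sigma> \<le> \<tau>, against the antichain. The source
  may be any rank-one subgroup of type \<open>\<sigma>\<close>, so summands of other decompositions
  are covered too.\<close>

lemma hom_between_summands_trivial:
  assumes "\<sigma> \<in> T" "\<tau> \<in> T" "\<sigma> \<noteq> \<tau>" "rk G A = 1" "subgroup A G" "type_of G A = \<sigma>"
    and "h \<in> hom (G\<lparr>carrier := A\<rparr>) (G\<lparr>carrier := F \<tau>\<rparr>)" "s \<in> A"
  shows "h s = \<one>"
proof (rule ccontr)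
  assume "h s \<noteq> \<one>"
  then have "type_le \<sigma> \<tau>"
    using type_leI[of A "F \<tau>" h s] assms rank_one summand_subgroup summand_type by auto
  then show False using antichain assms by blast
qed

text \<open>The coordinate maps from \<open>A\<close> to summands of other types are trivial, so
  only the coordinate at \<open>\<rho>\<close> survives.\<close>

lemma summand_subset_of_type:
  assumes "\<rho> \<in> T" "rk G A = 1" "subgroup A G" "type_of G A = \<rho>" "A \<subseteq> R"
  shows "A \<subseteq> F \<rho>"
proof
  fix y assume y: "y \<in> A"
  show "y \<in> F \<rho>"
  proof (rule in_summandI)
    fix \<sigma> assume \<sigma>: "\<sigma> \<in> T" "\<sigma> \<noteq> \<rho>"
    have "component \<sigma> \<in> hom (G\<lparr>carrier := A\<rparr>) (G\<lparr>carrier := F \<sigma>\<rparr>)"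
      using component_hom[OF \<sigma>(1)] assms(5) by (auto simp: hom_def Pi_iff subset_iff)
    then show "component \<sigma> y = \<one>"
      using hom_between_summands_trivial[OF assms(1) \<sigma>(1) _ assms(2,3,4)] \<sigma> y by blast
  qed (use assms y in auto)
qed

text \<open>
  Every summand \<open>F \<tau>\<close> lies in a single rank-one summand of each regulating subgroup \<open>W\<close>: up to a
  multiple, the projections of \<open>W\<close> induce maps from \<open>F \<tau>\<close> to \<open>F \<sigma>\<close>, which vanish for \<open>\<sigma> \<noteq> \<tau>\<close>.
\<close>

lemma regulator_summand_pure:
  assumes acd: "almost_completely_decomposable G" and R: "R = regulator G"
    and \<tau>: "\<tau> \<in> T" and y: "y \<in> carrier G" "y [^] (N::int) \<in> F \<tau>" "N \<noteq> 0"
  shows "y \<in> F \<tau>"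
proof -
  obtain n :: nat where n: "0 < n" "\<And>x. x \<in> carrier G \<Longrightarrow> x [^] n \<in> R"
    using regulator_exponent[OF acd] R by auto
  define r where "r = y [^] N"
  have r: "r \<in> F \<tau>" "r \<in> R" using y summand_in[OF \<tau>] by (auto simp: r_def)
  have "y \<in> W" if W: "regulating G W" for W
  proof -
    have RW: "R \<subseteq> W" using W R unfolding regulator_def by blast
    obtain k :: nat and E where E: "direct_decomp G W {..<k} E"
      and rkE: "\<And>i. i < k \<Longrightarrow> rk G (E i) = 1"
      using W unfolding regulating_def finite_index_cd_def completely_decomposable_def by auto
    interpret W: torsion_free_direct_sum G W "{..<k}" E by unfold_locales (rule E)
    \<comment> \<open>A coordinate with respect to \<open>W\<close> need not lie in
      \<open>R\<close>, but its \<open>n\<close>-th power does, so that it can be projected further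
      to \<open>F \<sigma>\<close>.\<close>
    have comp: "W.component i r [^] n \<in> F \<tau>" if i: "i \<in> {..<k}" for i
    proof (rule in_summandI[OF _ \<tau>])
      show "W.component i r [^] n \<in> R" using n(2) W.component_carrier[OF _ i] r RW by auto
      fix \<sigma> assume \<sigma>: "\<sigma> \<in> T" "\<sigma> \<noteq> \<tau>"
      let ?h = "\<lambda>s. component \<sigma> (W.component i s [^] n)"
      have sW: "s \<in> W" "W.component i s \<in> carrier G" if "s \<in> F \<tau>" for s
        using summand_in[OF \<tau> that] RW W.component_carrier[OF _ i] by auto
      have "?h \<in> hom (G\<lparr>carrier := F \<tau>\<rparr>) (G\<lparr>carrier := F \<sigma>\<rparr>)"
      proof (rule homI)
        fix s t assume "s \<in> carrier (G\<lparr>carrier := F \<tau>\<rparr>)" "t \<in> carrier (G\<lparr>carrier := F \<tau>\<rparr>)"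
        then have st: "s \<in> F \<tau>" "t \<in> F \<tau>" by simp_all
        have "W.component i (s \<otimes> t) [^] n = W.component i s [^] n \<otimes> W.component i t [^] n"
          using sW[OF st(1)] sW[OF st(2)] W.component_mult[OF _ _ i] by (simp add: nat_pow_distrib)
        then show "?h (s \<otimes>\<^bsub>G\<lparr>carrier := F \<tau>\<rparr>\<^esub> t) = ?h s \<otimes>\<^bsub>G\<lparr>carrier := F \<sigma>\<rparr>\<^esub> ?h t"
          using component_mult[OF n(2)[OF sW(2)[OF st(1)]] n(2)[OF sW(2)[OF st(2)]] \<sigma>(1)] by simp
      qed (use component_in[OF n(2)[OF sW(2)] \<sigma>(1)] in simp)
      then show "?h r = \<one>"
        using hom_between_summands_trivial[OF \<tau> \<sigma>(1) \<sigma>(2)[symmetric] rank_one[OF \<tau>]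
            summand_subgroup[OF \<tau>] summand_type[OF \<tau>] _ r(1)] by blast
    qed
    show "y \<in> W"
    proof (cases "y = \<one>")
      case True then show ?thesis using W.one_in by simp
    next
      case False
      have "r \<noteq> \<one>" using int_pow_eq_one_iff[OF y(1)] y False by (simp add: r_def)
      have rW: "r \<in> W" using r RW by blast
      have "\<exists>i\<in>{..<k}. W.component i r \<noteq> \<one>"
      proof (rule ccontr)
        assume trivial: "\<not> (\<exists>i\<in>{..<k}. W.component i r \<noteq> \<one>)"
        have "r = \<one>"
        proof (rule W.component_eqI[OF rW W.one_in])
          fix i assume i: "i \<in> {..<k}"
          show "W.component i r = W.component i \<one>"
            using W.component_int_pow[OF rW i, of 0] trivial i by simp
        qed
        then show False using \<open>r \<noteq> \<one>\<close> by simp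
      qed
      then obtain i where i: "i \<in> {..<k}" "W.component i r \<noteq> \<one>" by blast
      have pow_ne: "c [^] n \<noteq> \<one>" if "c \<in> carrier G" "c \<noteq> \<one>" for c
        using int_pow_eq_one_iff[OF that(1), of "int n"] that n(1) by (simp add: int_pow_int)
      \<comment> \<open>Two nontrivial coordinates of \<open>r\<close> would have
        \<open>n\<close>-th powers in the rank-one group \<open>F \<tau>\<close>, hence dependent,
        although they belong to different summands of \<open>W\<close>.\<close>
      have "r \<in> E i"
      proof (rule W.in_summandI[OF rW i(1)])
        fix j assume j: "j \<in> {..<k}" "j \<noteq> i"
        let ?u = "W.component i r [^] n" and ?w = "W.component j r [^] n"
        show "W.component j r = \<one>"
        proof (rule ccontr)
          assume "W.component j r \<noteq> \<one>"
          have uE: "?u \<in> E i"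
            using subgroup_int_pow_closed[OF W.summand_subgroup[OF i(1)]
                W.component_in[OF rW i(1)], of "int n"] by (simp add: int_pow_int)
          have wE: "?w \<in> E j"
            using subgroup_int_pow_closed[OF W.summand_subgroup[OF j(1)]
                W.component_in[OF rW j(1)], of "int n"] by (simp add: int_pow_int)
          have "?u \<noteq> \<one>" using pow_ne i(2) W.component_carrier[OF rW i(1)] by blast
          then obtain a b :: int where ab: "0 < b" "?w [^] b = ?u [^] a"
            using rank_one_dependent[OF rank_one[OF \<tau>] summand_carrier[OF \<tau>] comp[OF i(1)] _
                comp[OF j(1)]] by blast
          have "?w [^] b \<in> E i"
            using subgroup_int_pow_closed[OF W.summand_subgroup[OF i(1)] uE] ab(2) by simp
          moreover have wbE: "?w [^] b \<in> E j"
            using subgroup_int_pow_closed[OF W.summand_subgroup[OF j(1)] wE] .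
          ultimately have "?w [^] b = \<one>"
            using W.component_summand[OF i(1), of "?w [^] b" j]
              W.component_summand[OF j(1) wbE j(1)] j by simp
          moreover have "?w \<noteq> \<one>"
            using pow_ne \<open>W.component j r \<noteq> \<one>\<close> W.component_carrier[OF rW j(1)] by blast
          ultimately show False
            using int_pow_eq_one_iff[of ?w b] ab(1) W.component_carrier[OF rW j(1)] by auto
        qed
      qed
      then have "y \<in> E i"
        using regulating_summand_pure[OF W E rkE _ y(1) _ y(3)] i(1) by (simp add: r_def)
      then show ?thesis using W.summand_in[OF i(1)] by blast
    qed
  qed
  then have "y \<in> R" using R unfolding regulator_def by blast
  then show ?thesis using summand_pure[OF _ \<tau> y(2,3)] by blast
qed

text \<open>By purity, every rational multiple of \<open>v\<close> in \<open>R\<close> already lies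
  in \<open>F \<rho>\<close>. So coefficients may be computed in \<open>F \<rho>\<close>, where rank
  one makes every element a multiple of \<open>v\<close>.\<close>

lemma rank_one_rat_multiples:
  assumes \<rho>: "\<rho> \<in> T" and v: "v \<in> F \<rho>" "v \<noteq> \<one>"
  shows coeff_group_in: "coeff_group G R v \<in> \<rho>"
    and rat_multiples_eq: "rat_multiples G (coeff_group G R v) v = F \<rho>"
proof -
  have vc: "v \<in> carrier G" using v summand_carrier[OF \<rho>] by blast
  have in_summand: "y \<in> F \<rho>" if y: "y \<in> R" "is_rat_multiple G q v y" for q y
  proof -
    obtain m n where "0 < n" "y [^] (n::int) = v [^] (m::int)"
      using y unfolding is_rat_multiple_def by auto
    then show ?thesis
      using summand_pure[OF y(1) \<rho>, of n] subgroup_int_pow_closed[OF summand_subgroup[OF \<rho>] v(1)]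
      by auto
  qed
  have "coeff_group G R v = coeff_group G (F \<rho>) v"
    using in_summand summand_in[OF \<rho>] unfolding coeff_group_def by blast
  then show "coeff_group G R v \<in> \<rho>"
    using coeff_group_in_type_of[OF rank_one[OF \<rho>] summand_subgroup[OF \<rho>] v] summand_type[OF \<rho>]
    by simp
  show "rat_multiples G (coeff_group G R v) v = F \<rho>"
  proof
    show "rat_multiples G (coeff_group G R v) v \<subseteq> F \<rho>"
    proof
      fix y assume "y \<in> rat_multiples G (coeff_group G R v) v"
      then obtain q z where q: "y \<in> carrier G" "is_rat_multiple G q v y"
        "z \<in> R" "is_rat_multiple G q v z"
        unfolding rat_multiples_def coeff_group_def by auto
      then have "y = z" using is_rat_multiple_unique vc in_carrier by blast
      then show "y \<in> F \<rho>" using in_summand q by blast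
    qed
    show "F \<rho> \<subseteq> rat_multiples G (coeff_group G R v) v"
    proof
      fix y assume y: "y \<in> F \<rho>"
      obtain q where "is_rat_multiple G q v y"
        using rank_one_rat_multiple[OF rank_one[OF \<rho>] summand_carrier[OF \<rho>] v y] by blast
      then show "y \<in> rat_multiples G (coeff_group G R v) v"
        using y summand_in[OF \<rho> y] summand_carrier[OF \<rho>]
        unfolding rat_multiples_def coeff_group_def by blast
    qed
  qed
qed

text \<open>Projecting a witness from \<open>R\<close> to \<open>F \<tau>\<close> leaves the
  equation intact, since its left-hand side is its own \<open>\<tau>\<close>-coordinate.\<close>

lemma ord_mod_summand_dvd_iff:
  assumes \<tau>: "\<tau> \<in> T" and a: "a \<in> F \<tau>"
  shows "ord_mod G R e a dvd k \<longleftrightarrow> (\<exists>r\<in>F \<tau>. a [^] k = r [^] e)"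
proof -
  have "\<exists>r\<in>F \<tau>. a [^] k = r [^] e" if r: "r \<in> R" "a [^] k = r [^] e" for r
  proof -
    have "component \<tau> (a [^] k) = component \<tau> (r [^] e)" using r by simp
    then have "a [^] k = component \<tau> r [^] e"
      using component_pow[OF summand_in[OF \<tau> a] \<tau>] component_pow[OF r(1) \<tau>]
        component_summand[OF \<tau> a \<tau>] by simp
    then show ?thesis using component_in[OF r(1) \<tau>] by blast
  qed
  then show ?thesis
    using ord_mod_dvd_iff[OF sum_subgroup summand_in[OF \<tau> a]] summand_in[OF \<tau>] by blast
qed

text \<open>
  The right-hand side does not mention \<open>e\<close> and \<open>a\<close>: it says that \<open>k\<close> annihilates the projection of
  \<open>G/R\<close> to the \<open>\<tau>\<close>-component of the divisible hull. Hence \<open>\<mu>\<^sub>\<tau>\<close> is well defined.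
\<close>

lemma ord_mod_described_dvd_iff:
  assumes \<tau>: "\<tau> \<in> T" and a: "a \<in> Pi T F" and "described_by G R e (\<Otimes>\<rho>\<in>T. a \<rho>)"
  shows "ord_mod G R e (a \<tau>) dvd k \<longleftrightarrow>
    (\<forall>y\<in>carrier G. \<forall>n::nat. 0 < n \<longrightarrow> y [^] n \<in> R \<longrightarrow>
      (\<exists>r\<in>F \<tau>. component \<tau> (y [^] n) [^] k = r [^] n))" (is "_ \<longleftrightarrow> ?rhs")
proof -
  obtain x where x: "x \<in> carrier G" "x [^] e = (\<Otimes>\<rho>\<in>T. a \<rho>)"
    and gen: "carrier G = R <#> range (\<lambda>k::int. x [^] k)" and e: "0 < e"
    using assms(3) unfolding described_by_def by auto
  have a\<tau>: "a \<tau> \<in> F \<tau>" using a \<tau> by blast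
  have xe: "x [^] e \<in> R" "component \<tau> (x [^] e) = a \<tau>"
    using finprod_in[OF a] component_finprod[OF a \<tau>] x by auto
  have Fc: "z \<in> carrier G" if "z \<in> F \<tau>" for z using that summand_carrier[OF \<tau>] by blast
  have "?rhs" if annihilated: "\<exists>r\<in>F \<tau>. a \<tau> [^] k = r [^] e"
  proof (intro ballI allI impI)
    obtain r where r: "r \<in> F \<tau>" "a \<tau> [^] k = r [^] e" using annihilated by auto
    \<comment> \<open>In additive notation, let \<open>y = s + j x\<close> and let \<open>c\<close>
      be the \<open>\<tau>\<close>-coordinate of \<open>n y\<close>. Then
      \<open>e c = n (e s' + j a')\<close>, where \<open>s'\<close> and \<open>a'\<close> are the
      \<open>\<tau>\<close>-coordinates of \<open>s\<close> and \<open>e x\<close>. Multiplying by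
      \<open>k\<close> and using \<open>k a' = e r\<close>, the factor \<open>e\<close> cancels:
      \<open>k c = n (k s' + j r)\<close>.\<close>
    fix y and n :: nat assume y: "y \<in> carrier G" "0 < n" "y [^] n \<in> R"
    obtain s j where s: "s \<in> R" "y = s \<otimes> x [^] (j::int)"
      using y(1) gen unfolding set_mult_def by auto
    let ?c = "component \<tau> (y [^] n)" and ?s = "component \<tau> s"
    have ss: "?s \<in> F \<tau>" using component_in s \<tau> by blast
    have ye: "y [^] e = s [^] e \<otimes> (x [^] e) [^] j"
      unfolding s(2) using x(1) in_carrier[OF s(1)]
      by (simp add: int_pow_distrib int_pow_int[symmetric] int_pow_pow mult.commute)
    have "?c [^] e = component \<tau> ((y [^] n) [^] e)" using component_pow[OF y(3) \<tau>] by simp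
    also have "(y [^] n) [^] e = (y [^] e) [^] n" using y(1) by (simp add: nat_pow_pow mult.commute)
    also have "component \<tau> \<dots> = (?s [^] e \<otimes> a \<tau> [^] j) [^] n"
      unfolding ye using s xe \<tau> pow_in int_pow_in mult_in
      by (simp add: component_pow component_mult component_int_pow)
    finally have "?c [^] e = (?s [^] e \<otimes> a \<tau> [^] j) [^] n" .
    then have "(?c [^] e) [^] k = ((?s [^] e \<otimes> a \<tau> [^] j) [^] n) [^] k" by simp
    also have "\<dots> = ((?s [^] e) [^] k \<otimes> (a \<tau> [^] k) [^] j) [^] n"
      using Fc[OF ss] Fc[OF a\<tau>]
      by (simp add: nat_pow_distrib int_pow_int[symmetric] int_pow_pow int_pow_distrib mult_ac)
    also have "\<dots> = (((?s [^] k) \<otimes> r [^] j) [^] n) [^] e"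
      unfolding r(2) using Fc[OF ss] Fc[OF r(1)]
      by (simp add: nat_pow_distrib int_pow_int[symmetric] int_pow_pow int_pow_distrib mult_ac)
    finally have "(?c [^] k) [^] e = (((?s [^] k) \<otimes> r [^] j) [^] n) [^] e"
      using component_carrier[OF y(3) \<tau>] by (simp add: nat_pow_pow mult.commute)
    then have "?c [^] k = ((?s [^] k) \<otimes> r [^] j) [^] n"
      using pow_cancel e Fc[OF ss] Fc[OF r(1)] component_carrier[OF y(3) \<tau>] by simp
    moreover have "?s [^] k \<otimes> r [^] j \<in> F \<tau>"
      using subgroup.m_closed[OF summand_subgroup[OF \<tau>]]
        subgroup_int_pow_closed[OF summand_subgroup[OF \<tau>] ss, of "int k"]
        subgroup_int_pow_closed[OF summand_subgroup[OF \<tau>] r(1)] by (simp add: int_pow_int)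
    ultimately show "\<exists>r\<in>F \<tau>. ?c [^] k = r [^] n" by blast
  qed
  \<comment> \<open>The converse is the instance \<open>y = x\<close>, \<open>n = e\<close>.\<close>
  moreover have "\<exists>r\<in>F \<tau>. a \<tau> [^] k = r [^] e" if ?rhs
    using that x(1) e xe by metis
  ultimately show ?thesis using ord_mod_summand_dvd_iff[OF \<tau> a\<tau>] by blast
qed

text \<open>\<open>mu\<close> ranges over all homogeneous decompositions. Here there is only one,
  because summands of equal type contain each other.\<close>

lemma homogeneous_decomposition_unique:
  assumes "rigid_decomposition G R T F'" "\<rho> \<in> T"
  shows "F' \<rho> = F \<rho>"
proof
  interpret F': rigid_decomposition G R T F' by (rule assms)
  show "F' \<rho> \<subseteq> F \<rho>"
    using summand_subset_of_type assms F'.rank_one F'.summand_type F'.summand_subgroup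
      F'.summand_in by blast
  show "F \<rho> \<subseteq> F' \<rho>"
    using F'.summand_subset_of_type assms rank_one summand_type summand_subgroup summand_in by blast
qed

lemma ord_mod_omit_component:
  assumes \<tau>: "\<tau> \<in> T" and a: "a \<in> Pi T F"
    and pure: "\<And>y. y \<in> carrier G \<Longrightarrow> y [^] e \<in> F \<tau> \<Longrightarrow> y \<in> F \<tau>"
    and x: "x \<in> carrier G" "x [^] e = (\<Otimes>\<rho>\<in>T. a \<rho>)"
    and ord: "\<And>k. x [^] k \<in> R \<longleftrightarrow> e dvd k"
  shows "ord_mod G R e (\<Otimes>\<rho>\<in>T - {\<tau>}. a \<rho>) = e"
proof -
  let ?b = "\<Otimes>\<rho>\<in>T - {\<tau>}. a \<rho>"
  have b: "?b \<in> R" using finprod_subset_in[of "T - {\<tau>}" a] a by auto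
  have ac: "a \<in> T \<rightarrow> carrier G" using family_carrier[OF a] .
  have a\<tau>: "a \<tau> \<in> F \<tau>" using a \<tau> by blast
  have a\<tau>c: "a \<tau> \<in> carrier G" using ac \<tau> by blast
  have split: "(\<Otimes>\<rho>\<in>T. a \<rho>) = a \<tau> \<otimes> ?b"
    using finprod_insert[of "T - {\<tau>}" \<tau> a] finite_index ac a\<tau>c \<tau> by (auto simp: insert_absorb)
  have "e dvd k" if k: "ord_mod G R e ?b dvd k" for k
  proof -
    obtain s where s: "s \<in> R" "?b [^] k = s [^] e"
      using ord_mod_dvd_iff[OF sum_subgroup b] k by blast
    have sc: "s \<in> carrier G" using in_carrier s by blast
    \<comment> \<open>Additively, \<open>y = k x - s\<close> with \<open>e s\<close> equal to
      \<open>k\<close> times the shortened sum. Hence \<open>e y\<close> is \<open>k\<close> times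
      the omitted component, and purity puts \<open>y\<close> into \<open>F \<tau>\<close>.\<close>
    let ?y = "x [^] k \<otimes> inv s"
    have "(x [^] k) [^] e = (x [^] e) [^] k" using x(1) by (simp add: nat_pow_pow mult.commute)
    also have "\<dots> = a \<tau> [^] k \<otimes> s [^] e"
      unfolding x(2) split using a\<tau>c in_carrier[OF b] s(2) by (simp add: nat_pow_distrib)
    finally have "?y [^] e = a \<tau> [^] k"
      using x(1) sc a\<tau>c by (simp add: nat_pow_distrib nat_pow_inv m_assoc)
    then have "?y [^] e \<in> F \<tau>"
      using subgroup_int_pow_closed[OF summand_subgroup[OF \<tau>] a\<tau>, of "int k"]
      by (simp add: int_pow_int)
    then have "?y \<in> R" using pure[of ?y] x(1) sc summand_in[OF \<tau>] by simp
    then have "?y \<otimes> s \<in> R" using s mult_in by blast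
    then have "x [^] k \<in> R" using x(1) sc by (simp add: m_assoc)
    then show ?thesis using ord by blast
  qed
  then have "e dvd ord_mod G R e ?b" by simp
  then show ?thesis using ord_mod_dvd[OF sum_subgroup b] dvd_antisym by blast
qed

section \<open>Decomposition bases and the number of critical types\<close>

lemma decomposition_basis_family:
  assumes v: "\<And>\<rho>. \<rho> \<in> T \<Longrightarrow> v \<rho> \<in> F \<rho> \<and> v \<rho> \<noteq> \<one>"
  shows "decomposition_basis G R (v ` T)"
  unfolding decomposition_basis_def
proof (intro conjI)
  have eq: "rat_multiples G (coeff_group G R (v \<rho>)) (v \<rho>) = F \<rho>" if "\<rho> \<in> T" for \<rho>
    using rat_multiples_eq[OF that] v[OF that] by blast
  show "v ` T \<subseteq> R - {\<one>}" using v summand_in by auto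
  show "direct_decomp G R (v ` T) (\<lambda>v. rat_multiples G (coeff_group G R v) v)"
    by (rule direct_decomp_reindex[OF inj_on_nontrivial_family[OF v] eq])
  show "\<forall>w\<in>v ` T. rk G (rat_multiples G (coeff_group G R w) w) = 1"
    using eq rank_one by auto
qed

text \<open>Choose a nontrivial element in each summand. A relation between them holds
  coordinatewise, so they are independent.\<close>

lemma card_le_rank: "card T \<le> rk G (carrier G)"
proof -
  have "\<exists>w. \<forall>\<rho>\<in>T. w \<rho> \<in> F \<rho> \<and> w \<rho> \<noteq> \<one>"
    using rank_one_nontrivial[OF rank_one summand_carrier] by (intro bchoice) blast
  then obtain w where w: "\<And>\<rho>. \<rho> \<in> T \<Longrightarrow> w \<rho> \<in> F \<rho> \<and> w \<rho> \<noteq> \<one>" by blast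
  have inj: "inj_on w T" using inj_on_nontrivial_family w by blast
  have wc: "w \<rho> \<in> carrier G" if "\<rho> \<in> T" for \<rho> using w summand_carrier that by blast
  have "Z_independent G (w ` T)"
    unfolding Z_independent_def
  proof (intro conjI allI impI ballI)
    fix c :: "'a \<Rightarrow> int" and b assume c: "(\<Otimes>b\<in>w ` T. b [^] c b) = \<one>" and "b \<in> w ` T"
    then obtain \<rho> where \<rho>: "\<rho> \<in> T" "b = w \<rho>" by blast
    let ?f = "\<lambda>\<rho>. w \<rho> [^] c (w \<rho>)"
    have f: "?f \<in> Pi T F" using w subgroup_int_pow_closed summand_subgroup by blast
    have "(\<Otimes>\<rho>\<in>T. ?f \<rho>) = \<one>" 
      using c wc by (subst finprod_reindex[OF _ inj, of "\<lambda>b. b [^] c b", symmetric]) auto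
    then have "?f \<rho> = component \<rho> \<one>" using component_finprod[OF f \<rho>(1)] by simp
    also have "\<dots> = \<one>" using component_int_pow[OF one_in \<rho>(1), of 0] by simp
    finally show "c b = 0" using int_pow_eq_one_iff[OF wc[OF \<rho>(1)]] w[OF \<rho>(1)] \<rho>(2) by simp
  qed (use finite_index wc in auto)
  then have "card (w ` T) \<le> rk G (carrier G)" using wc by (intro card_le_rk) auto
  then show ?thesis using card_image[OF inj] by simp
qed

text \<open>Multiplication by \<open>n\<close> moves any two elements into a summand of rank one, or
  to \<open>\<one>\<close> if \<open>T\<close> is empty, and dependence there lifts back.\<close>

lemma rank_le_one_if_single_type:
  assumes n: "0 < n" "\<And>x. x \<in> carrier G \<Longrightarrow> x [^] (n::nat) \<in> R" and T: "T \<subseteq> {\<rho>}"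
  shows "rk G (carrier G) \<le> 1"
proof (rule rank_le_oneI)
  fix x y assume x: "x \<in> carrier G" and y: "y \<in> carrier G"
  show "\<exists>(a::int) (b::int). (a \<noteq> 0 \<or> b \<noteq> 0) \<and> x [^] a = y [^] b"
  proof (cases "x [^] n = \<one>")
    case True
    then show ?thesis
      using n(1) by (intro exI[of _ "int n"] exI[of _ "0::int"]) (simp add: int_pow_int)
  next
    case False
    have "\<rho> \<in> T"
    proof (rule ccontr)
      assume "\<rho> \<notin> T"
      then have "x [^] n = \<one>" using T by (intro component_eqI[OF n(2)[OF x] one_in]) auto
      then show False using False by simp
    qed
    then have F: "z \<in> F \<rho>" if "z \<in> R" for z using in_summandI[OF that] T by blast
    obtain a b :: int where ab: "0 < b" "(y [^] n) [^] b = (x [^] n) [^] a"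
      using rank_one_dependent[OF rank_one[OF \<open>\<rho> \<in> T\<close>] summand_carrier[OF \<open>\<rho> \<in> T\<close>]
          F[OF n(2)[OF x]] False F[OF n(2)[OF y]]] by blast
    then have "x [^] (int n * a) = y [^] (int n * b)"
      using x y by (simp add: int_pow_int[symmetric] int_pow_pow)
    then show ?thesis using ab n(1)
      by (intro exI[of _ "int n * a"] exI[of _ "int n * b"]) simp
  qed
qed simp

text \<open>Two descriptions are returned: \<open>a\<close> belongs to the first generator and
  defines \<open>\<alpha>\<close>, while \<open>v\<close> belongs to a generator changed by an
  element of \<open>R\<close>. The former serves to compute \<open>mu\<close>, the latter gives the
  basis.\<close>

lemma rigid_description:
  assumes acd: "almost_completely_decomposable G" and R: "R = regulator G"
    and cyclic: "cyclic_group (G Mod R)"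
  obtains e :: nat and a v :: "rtype \<Rightarrow> 'a" and \<alpha> :: "rtype \<Rightarrow> nat"
  where "e = card (rcosets R)" "0 < e" "\<And>x. x \<in> carrier G \<Longrightarrow> x [^] e \<in> R"
    "a \<in> Pi T F" "described_by G R e (\<Otimes>\<rho>\<in>T. a \<rho>)"
    "\<And>\<rho>. \<rho> \<in> T \<Longrightarrow> ord_mod G R e (a \<rho>) * \<alpha> \<rho> = e"
    "\<And>\<rho>. \<rho> \<in> T \<Longrightarrow> v \<rho> \<in> F \<rho> \<and> v \<rho> \<noteq> \<one>"
    "described_by G R e (\<Otimes>\<rho>\<in>T. v \<rho> [^] \<alpha> \<rho>)"
    "\<And>\<tau>. \<tau> \<in> T \<Longrightarrow> ord_mod G R e (\<Otimes>\<rho>\<in>T - {\<tau>}. v \<rho> [^] \<alpha> \<rho>) = e"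
proof -
  define e where "e = card (rcosets R)"
  obtain x where x: "x \<in> carrier G" and gen: "carrier G = R <#> range (\<lambda>k::int. x [^] k)"
    and ord: "\<And>k. x [^] k \<in> R \<longleftrightarrow> e dvd k"
    using cyclic_quotient_generator[OF sum_subgroup cyclic] unfolding e_def by blast
  obtain n :: nat where n: "0 < n" "\<And>x. x \<in> carrier G \<Longrightarrow> x [^] n \<in> R"
    using regulator_exponent[OF acd] R by auto
  \<comment> \<open>An infinite index would have \<open>card\<close> equal to \<open>0\<close>; a
    positive \<open>n\<close> with \<open>x [^] n \<in> R\<close> must be divisible by
    \<open>e\<close>, which excludes this.\<close>
  have e: "0 < e" using ord[of n] n x by (cases e) auto
  have exp: "y [^] e \<in> R" if "y \<in> carrier G" for y
    using pow_index_in[OF sum_subgroup that] by (simp add: e_def)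
  define a where "a \<rho> = component \<rho> (x [^] e)" for \<rho>
  have a: "a \<in> Pi T F" using component_in[OF exp[OF x]] by (auto simp: a_def)
  have xa: "x [^] e = (\<Otimes>\<rho>\<in>T. a \<rho>)" using finprod_component[OF exp[OF x]] by (simp add: a_def)
  define m where "m \<rho> = ord_mod G R e (a \<rho>)" for \<rho>
  define \<alpha> where "\<alpha> \<rho> = e div m \<rho>" for \<rho>
  have m: "m \<rho> * \<alpha> \<rho> = e" if "\<rho> \<in> T" for \<rho>
  proof -
    have "a \<rho> \<in> R" using summand_in[OF that] a that by blast
    then show ?thesis using ord_mod_dvd[OF sum_subgroup, of "a \<rho>" e] by (simp add: m_def \<alpha>_def)
  qed
  \<comment> \<open>\<open>s [^] e\<close> is a correction in \<open>eR\<close> that keeps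
    \<open>v\<close> nontrivial. If \<open>a \<rho>\<close> is trivial, then
    \<open>\<alpha> \<rho> = e\<close> and \<open>s = v\<close> works; otherwise
    \<open>s = \<one>\<close>.\<close>
  have "\<exists>v s. v \<in> F \<rho> \<and> v \<noteq> \<one> \<and> s \<in> F \<rho> \<and> v [^] \<alpha> \<rho> = a \<rho> \<otimes> s [^] e" if \<rho>: "\<rho> \<in> T" for \<rho>
  proof -
    have a\<rho>: "a \<rho> \<in> F \<rho>" "a \<rho> \<in> carrier G" using a \<rho> summand_carrier by auto
    show ?thesis
    proof (cases "a \<rho> = \<one>")
      case True
      obtain v where v: "v \<in> F \<rho>" "v \<noteq> \<one>"
        using rank_one_nontrivial[OF rank_one[OF \<rho>] summand_carrier[OF \<rho>]] by blast
      have "\<exists>r\<in>F \<rho>. a \<rho> [^] (1::nat) = r [^] e"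
        using True subgroup.one_closed[OF summand_subgroup[OF \<rho>]]
        by (intro bexI[of _ \<one>]) simp_all
      then have "m \<rho> dvd 1" unfolding m_def ord_mod_summand_dvd_iff[OF \<rho> a\<rho>(1)] .
      then have "\<alpha> \<rho> = e" using m[OF \<rho>] by simp
      then show ?thesis using v True summand_carrier[OF \<rho>] by (intro exI[of _ v]) auto
    next
      case False
      obtain r where r: "r \<in> F \<rho>" "a \<rho> [^] m \<rho> = r [^] e"
        using ord_mod_summand_dvd_iff[OF \<rho> a\<rho>(1), of e "m \<rho>"] unfolding m_def by auto
      have rc: "r \<in> carrier G" using r summand_carrier[OF \<rho>] by blast
      \<comment> \<open>Since \<open>e = m \<rho> * \<alpha> \<rho>\<close>, the exponent
        \<open>m \<rho>\<close> can be cancelled from the witness equation for the order.\<close>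
      have "a \<rho> [^] m \<rho> = (r [^] \<alpha> \<rho>) [^] m \<rho>"
        using r(2) rc m[OF \<rho>] by (simp add: nat_pow_pow mult.commute)
      moreover have "0 < m \<rho>" using m[OF \<rho>] e by (cases "m \<rho>") simp_all
      ultimately have "a \<rho> = r [^] \<alpha> \<rho>" using pow_cancel[OF a\<rho>(2)] rc by blast
      then show ?thesis using False r rc subgroup.one_closed[OF summand_subgroup[OF \<rho>]]
        by (intro exI[of _ r] exI[of _ \<one>]) auto
    qed
  qed
  then obtain v s where vs: "\<And>\<rho>. \<rho> \<in> T \<Longrightarrow>
      v \<rho> \<in> F \<rho> \<and> v \<rho> \<noteq> \<one> \<and> s \<rho> \<in> F \<rho> \<and> v \<rho> [^] \<alpha> \<rho> = a \<rho> \<otimes> s \<rho> [^] e"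
    by metis
  have s: "s \<in> Pi T F" using vs by blast
  define S where "S = (\<Otimes>\<rho>\<in>T. s \<rho>)"
  have S: "S \<in> R" "S \<in> carrier G" using finprod_in[OF s] in_carrier by (auto simp: S_def)
  \<comment> \<open>All corrections are collected in \<open>S\<close>. As \<open>S \<in> R\<close>,
    the new element lies in the same coset of \<open>R\<close>, so it still generates the quotient
    and has the same order there.\<close>
  let ?x = "x \<otimes> S"
  have va: "(\<lambda>\<rho>. v \<rho> [^] \<alpha> \<rho>) \<in> Pi T F"
  proof
    fix \<rho> assume \<rho>: "\<rho> \<in> T"
    show "v \<rho> [^] \<alpha> \<rho> \<in> F \<rho>"
      using subgroup_int_pow_closed[OF summand_subgroup[OF \<rho>], of "v \<rho>" "int (\<alpha> \<rho>)"] vs[OF \<rho>]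
      by (simp add: int_pow_int)
  qed
  have sc: "s \<in> T \<rightarrow> carrier G" using family_carrier[OF s] .
  have "(\<Otimes>\<rho>\<in>T. v \<rho> [^] \<alpha> \<rho>) = (\<Otimes>\<rho>\<in>T. a \<rho> \<otimes> s \<rho> [^] e)"
    using vs family_carrier[OF a] sc by (intro finprod_cong') (auto simp: Pi_iff)
  also have "\<dots> = (\<Otimes>\<rho>\<in>T. a \<rho>) \<otimes> (\<Otimes>\<rho>\<in>T. s \<rho> [^] e)"
    using family_carrier[OF a] sc by (intro finprod_multf) (auto simp: Pi_iff)
  also have "(\<Otimes>\<rho>\<in>T. s \<rho> [^] e) = S [^] e"
    using finprod_pow[OF sc, of "int e"] by (simp add: S_def int_pow_int)
  finally have xv: "?x [^] e = (\<Otimes>\<rho>\<in>T. v \<rho> [^] \<alpha> \<rho>)"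
    using x S xa by (simp add: nat_pow_distrib)
  have gen': "carrier G = R <#> range (\<lambda>k::int. ?x [^] k)"
  proof
    show "R <#> range (\<lambda>k::int. ?x [^] k) \<subseteq> carrier G"
      using x S in_carrier by (intro set_mult_closed) auto
    show "carrier G \<subseteq> R <#> range (\<lambda>k::int. ?x [^] k)"
    proof
      fix y assume "y \<in> carrier G"
      then obtain r and k :: int where r: "r \<in> R" "y = r \<otimes> x [^] k"
        using gen unfolding set_mult_def by auto
      have "(r \<otimes> S [^] (- k)) \<otimes> ?x [^] k = r \<otimes> (S [^] (- k) \<otimes> (S [^] k \<otimes> x [^] k))"
        using x S in_carrier[OF r(1)] by (simp add: m_assoc int_pow_distrib m_comm)
      also have "\<dots> = y"
        using x S in_carrier[OF r(1)] r(2) by (simp add: int_pow_neg m_assoc[symmetric])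
      finally have "y = (r \<otimes> S [^] (- k)) \<otimes> ?x [^] k" by simp
      moreover have "r \<otimes> S [^] (- k) \<in> R" using mult_in int_pow_in r S by blast
      ultimately show "y \<in> R <#> range (\<lambda>k::int. ?x [^] k)" unfolding set_mult_def by blast
    qed
  qed
  have ord': "?x [^] k \<in> R \<longleftrightarrow> e dvd k" for k
  proof -
    have eq: "?x [^] k = x [^] k \<otimes> S [^] k" using x S by (simp add: nat_pow_distrib)
    have Sk: "S [^] k \<in> R" "S [^] k \<in> carrier G" using pow_in S by auto
    have "x [^] k \<in> R" if "x [^] k \<otimes> S [^] k \<in> R"
    proof -
      have "(x [^] k \<otimes> S [^] k) \<otimes> inv (S [^] k) \<in> R"
        using mult_in[OF that] subgroup.m_inv_closed[OF sum_subgroup Sk(1)] by blast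
      then show ?thesis using x Sk by (simp add: m_assoc)
    qed
    then show ?thesis using eq ord mult_in[OF _ Sk(1)] by auto
  qed
  have pure: "y \<in> F \<tau>" if "\<tau> \<in> T" "y \<in> carrier G" "y [^] e \<in> F \<tau>" for y \<tau>
    using regulator_summand_pure[OF acd R that(1,2), of "int e"] that e by (simp add: int_pow_int)
  show thesis
  proof (rule that[of e a \<alpha> v])
    show "described_by G R e (\<Otimes>\<rho>\<in>T. a \<rho>)"
      unfolding described_by_def using e x xa gen by blast
    show "described_by G R e (\<Otimes>\<rho>\<in>T. v \<rho> [^] \<alpha> \<rho>)"
      unfolding described_by_def using e x S xv gen' by blast
    show "ord_mod G R e (\<Otimes>\<rho>\<in>T - {\<tau>}. v \<rho> [^] \<alpha> \<rho>) = e" if "\<tau> \<in> T" for \<tau>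
      by (rule ord_mod_omit_component[OF that va pure[OF that] _ xv ord']) (use x S in auto)
    show "ord_mod G R e (a \<rho>) * \<alpha> \<rho> = e" if "\<rho> \<in> T" for \<rho>
      using m[OF that] by (simp add: m_def)
  qed (use e_def e exp a vs in auto)
qed

end

section \<open>Rigid almost completely decomposable groups with cyclic regulator quotient\<close>

context tffr
begin

lemma rigid_decompositionI:
  assumes "rigid G" and F: "homogeneous_decomposition G (regulator G) (Tcr G) F"
  shows "rigid_decomposition G (regulator G) (Tcr G) F"
proof unfold_locales
  show "direct_decomp G (regulator G) (Tcr G) F"
    using F unfolding homogeneous_decomposition_def by blast
  show rk1: "rk G (F \<rho>) = 1" if "\<rho> \<in> Tcr G" for \<rho>
    using assms that unfolding rigid_def by blast
  show "type_of G (F \<rho>) = \<rho>" if "\<rho> \<in> Tcr G" for \<rho>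
    using F that homogeneous_rank_one rk1 unfolding homogeneous_decomposition_def by blast
  show "\<sigma> = \<tau>" if "\<sigma> \<in> Tcr G" "\<tau> \<in> Tcr G" "type_le \<sigma> \<tau>" for \<sigma> \<tau>
    using assms(1) that unfolding rigid_def block_rigid_def by blast
qed

text \<open>Any competing choice uses the same summands, by uniqueness. Both orders then divide the
  same numbers \<open>k\<close>, by a criterion that mentions neither exponent nor element, so they
  agree.\<close>

lemma mu_eq_ord_mod:
  assumes rigid: "rigid G" and F: "homogeneous_decomposition G (regulator G) (Tcr G) F"
    and exp: "\<And>x. x \<in> carrier G \<Longrightarrow> x [^] e \<in> regulator G"
    and a: "a \<in> Pi (Tcr G) F" and desc: "described_by G (regulator G) e (\<Otimes>\<rho>\<in>Tcr G. a \<rho>)"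
    and \<tau>: "\<tau> \<in> Tcr G"
  shows "mu G \<tau> = ord_mod G (regulator G) e (a \<tau>)"
  unfolding mu_def
proof (rule the_equality)
  show "\<exists>e' F' a'. homogeneous_decomposition G (regulator G) (Tcr G) F' \<and>
      (\<forall>x\<in>carrier G. x [^] e' \<in> regulator G) \<and> a' \<in> (\<Pi> \<rho>\<in>Tcr G. F' \<rho>) \<and>
      described_by G (regulator G) e' (\<Otimes>\<rho>\<in>Tcr G. a' \<rho>) \<and>
      ord_mod G (regulator G) e (a \<tau>) =
        ord_mod G (regulator G) e' (if \<tau> \<in> Tcr G then a' \<tau> else \<one>)"
    using F exp a desc \<tau> by (intro exI[of _ e] exI[of _ F] exI[of _ a]) simp
next
  interpret F: rigid_decomposition G "regulator G" "Tcr G" F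
    by (rule rigid_decompositionI[OF rigid F])
  fix m assume "\<exists>e' F' a'. homogeneous_decomposition G (regulator G) (Tcr G) F' \<and>
      (\<forall>x\<in>carrier G. x [^] e' \<in> regulator G) \<and> a' \<in> (\<Pi> \<rho>\<in>Tcr G. F' \<rho>) \<and>
      described_by G (regulator G) e' (\<Otimes>\<rho>\<in>Tcr G. a' \<rho>) \<and>
      m = ord_mod G (regulator G) e' (if \<tau> \<in> Tcr G then a' \<tau> else \<one>)"
  then obtain e' F' a' where F': "homogeneous_decomposition G (regulator G) (Tcr G) F'"
    and a': "a' \<in> Pi (Tcr G) F'" and desc': "described_by G (regulator G) e' (\<Otimes>\<rho>\<in>Tcr G. a' \<rho>)"
    and m: "m = ord_mod G (regulator G) e' (a' \<tau>)"
    using \<tau> by auto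
  have "F' \<rho> = F \<rho>" if "\<rho> \<in> Tcr G" for \<rho>
    using F.homogeneous_decomposition_unique[OF rigid_decompositionI[OF rigid F'] that] .
  then have "a' \<in> Pi (Tcr G) F" using a' by auto
  then have "m dvd k \<longleftrightarrow> ord_mod G (regulator G) e (a \<tau>) dvd k" for k
    unfolding m using F.ord_mod_described_dvd_iff[OF \<tau>] a desc desc' by blast
  then show "m = ord_mod G (regulator G) e (a \<tau>)" by (meson dvd_antisym dvd_refl)
qed

end

theorem lemma5p12:
  fixes X :: "('a, 'b) monoid_scheme" (structure)
    and R :: "'a set" and Rc :: "rtype \<Rightarrow> 'a set"
  assumes B: "B_group X" and rigid: "rigid X"
    and R: "R = regulator X"
    and Rc: "homogeneous_decomposition X R (Tcr X) Rc"
  shows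
    "(\<exists>(e::nat) (\<alpha> :: rtype \<Rightarrow> nat) (v :: rtype \<Rightarrow> 'a).
        described_by X R e (\<Otimes>\<rho>\<in>Tcr X. v \<rho> [^] \<alpha> \<rho>) \<and>
        \<comment> \<open>(1)\<close>
        decomposition_basis X R (v ` Tcr X) \<and>
        direct_decomp X R (Tcr X) (\<lambda>\<rho>. rat_multiples X (coeff_group X R (v \<rho>)) (v \<rho>)) \<and>
        (\<forall>\<rho>\<in>Tcr X. coeff_group X R (v \<rho>) \<in> \<rho> \<and>
            rat_multiples X (coeff_group X R (v \<rho>)) (v \<rho>) = Rc \<rho>) \<and>
        \<comment> \<open>(2)\<close>
        (\<forall>\<tau>\<in>Tcr X. gcd_in X R e (\<Otimes>\<rho>\<in>Tcr X - {\<tau>}. v \<rho> [^] \<alpha> \<rho>) = 1) \<and>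
        \<comment> \<open>(3)\<close>
        e = card (rcosets R) \<and>
        \<comment> \<open>(4)\<close>
        (\<forall>\<rho>\<in>Tcr X. \<alpha> \<rho> dvd e) \<and>
        \<comment> \<open>(5)\<close>
        (\<forall>\<tau>\<in>Tcr X. mu X \<tau> = e div \<alpha> \<tau>))
     \<and> (\<forall>e::nat. rk X (carrier X) = 2 \<and> card (rcosets R) = e \<longrightarrow>
        (\<exists>v\<^sub>1 v\<^sub>2. v\<^sub>1 \<noteq> v\<^sub>2 \<and> decomposition_basis X R {v\<^sub>1, v\<^sub>2} \<and>
           described_by X R e (v\<^sub>1 \<otimes> v\<^sub>2) \<and>
           gcd_in X R e v\<^sub>1 = 1 \<and> gcd_in X R e v\<^sub>2 = 1))"
proof -
  let ?T = "Tcr X"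
  have acd: "almost_completely_decomposable X" and cyclic: "cyclic_group (X Mod R)"
    using B R unfolding B_group_def by auto
  have "comm_group X" "torsion_free X" "finite_rank X"
    using acd unfolding almost_completely_decomposable_def tffr_group_def by auto
  then interpret tffr X by (simp add: tffr_def torsion_free_group_def
        torsion_free_group_axioms_def tffr_axioms_def)
  interpret rigid_decomposition X R ?T Rc
    using rigid_decompositionI[OF rigid] Rc unfolding R by blast
  obtain e :: nat and a v :: "rtype \<Rightarrow> 'a" and \<alpha> :: "rtype \<Rightarrow> nat"
    where e: "e = card (rcosets R)" "0 < e" "\<And>x. x \<in> carrier X \<Longrightarrow> x [^] e \<in> R"
      and a: "a \<in> Pi ?T Rc" "described_by X R e (\<Otimes>\<rho>\<in>?T. a \<rho>)"
      and \<alpha>: "\<And>\<rho>. \<rho> \<in> ?T \<Longrightarrow> ord_mod X R e (a \<rho>) * \<alpha> \<rho> = e"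
      and v: "\<And>\<rho>. \<rho> \<in> ?T \<Longrightarrow> v \<rho> \<in> Rc \<rho> \<and> v \<rho> \<noteq> \<one>"
      and desc: "described_by X R e (\<Otimes>\<rho>\<in>?T. v \<rho> [^] \<alpha> \<rho>)"
      and omit: "\<And>\<tau>. \<tau> \<in> ?T \<Longrightarrow> ord_mod X R e (\<Otimes>\<rho>\<in>?T - {\<tau>}. v \<rho> [^] \<alpha> \<rho>) = e"
    by (rule rigid_description[OF acd R cyclic], rule that)
  have vc: "v \<rho> \<in> carrier X" if "\<rho> \<in> ?T" for \<rho> using v summand_carrier that by blast
  have basis: "decomposition_basis X R (v ` ?T)" using decomposition_basis_family v by blast
  have rat: "coeff_group X R (v \<rho>) \<in> \<rho>"
    "rat_multiples X (coeff_group X R (v \<rho>)) (v \<rho>) = Rc \<rho>" if "\<rho> \<in> ?T" for \<rho>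
    using coeff_group_in[OF that] rat_multiples_eq[OF that] v[OF that] by auto
  have "direct_decomp X R ?T (\<lambda>\<rho>. rat_multiples X (coeff_group X R (v \<rho>)) (v \<rho>))"
    using direct_decomp_reindex[of "\<lambda>\<rho>. \<rho>" "\<lambda>\<rho>. rat_multiples X (coeff_group X R (v \<rho>)) (v \<rho>)"]
      rat(2) by simp
  moreover have "mu X \<tau> = e div \<alpha> \<tau>" if \<tau>: "\<tau> \<in> ?T" for \<tau>
  proof -
    \<comment> \<open>The uncorrected coordinates \<open>a\<close> are used, since
      \<open>\<alpha>\<close> was defined from their orders; \<open>mu\<close> does not depend on
      the description.\<close>
    have "mu X \<tau> = ord_mod X R e (a \<tau>)"
      using mu_eq_ord_mod[OF rigid, of Rc e a \<tau>] Rc e(3) a \<tau> unfolding R by blast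
    moreover have "\<alpha> \<tau> \<noteq> 0" using \<alpha>[OF \<tau>] e(2) by (cases "\<alpha> \<tau>") auto
    ultimately show ?thesis using \<alpha>[OF \<tau>] by (metis nonzero_mult_div_cancel_right)
  qed
  moreover have "\<alpha> \<rho> dvd e" if "\<rho> \<in> ?T" for \<rho> using \<alpha>[OF that] by (metis dvd_triv_right)
  moreover have "gcd_in X R e (\<Otimes>\<rho>\<in>?T - {\<tau>}. v \<rho> [^] \<alpha> \<rho>) = 1" if "\<tau> \<in> ?T" for \<tau>
    unfolding gcd_in_def omit[OF that] using e(2) by simp
  moreover have "\<exists>v\<^sub>1 v\<^sub>2. v\<^sub>1 \<noteq> v\<^sub>2 \<and> decomposition_basis X R {v\<^sub>1, v\<^sub>2} \<and>
      described_by X R e (v\<^sub>1 \<otimes> v\<^sub>2) \<and> gcd_in X R e v\<^sub>1 = 1 \<and> gcd_in X R e v\<^sub>2 = 1"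
    if rk2: "rk X (carrier X) = 2"
  proof -
    \<comment> \<open>Independence of the summands allows at most two types, and at most one type
      would give rank at most one.\<close>
    have "card ?T = 2"
    proof -
      have "card ?T \<le> 2" using card_le_rank rk2 by simp
      moreover have "\<not> card ?T \<le> 1"
      proof
        assume "card ?T \<le> 1"
        then have "\<exists>\<rho>. ?T \<subseteq> {\<rho>}"
          using card_le_Suc0_iff_eq[OF finite_index] by (metis One_nat_def singleton_iff subsetI)
        then show False using rank_le_one_if_single_type[OF e(2,3)] rk2 by auto
      qed
      ultimately show ?thesis by simp
    qed
    then obtain \<sigma> \<tau> where T: "?T = {\<sigma>, \<tau>}" "\<sigma> \<noteq> \<tau>" by (auto simp: card_2_iff)
    have T': "?T - {\<tau>} = {\<sigma>}" "?T - {\<sigma>} = {\<tau>}" using T by auto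
    \<comment> \<open>With one of the two components omitted, the other has order \<open>e\<close>
      by (2). But \<open>e / \<alpha> \<rho>\<close> annihilates
      \<open>v \<rho> [^] \<alpha> \<rho>\<close> modulo \<open>eR\<close>, so \<open>e\<close>
      divides this quotient and \<open>\<alpha> \<rho> = 1\<close>.\<close>
    have full: "\<alpha> \<rho> = 1 \<and> gcd_in X R e (v \<rho>) = 1"
      if \<rho>: "\<rho> \<in> ?T" and ord: "ord_mod X R e (v \<rho> [^] \<alpha> \<rho>) = e" for \<rho>
    proof -
      obtain d where d: "e = \<alpha> \<rho> * d" using \<alpha>[OF \<rho>] by (metis mult.commute)
      have vR: "v \<rho> \<in> R" using summand_in \<rho> v by blast
      have "(v \<rho> [^] \<alpha> \<rho>) [^] d = v \<rho> [^] e" using vc[OF \<rho>] d by (simp add: nat_pow_pow)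
      then have "e dvd d"
        using ord_mod_dvd_iff[OF sum_subgroup pow_in[OF vR], of e "\<alpha> \<rho>" d] ord vR by auto
      then have "\<alpha> \<rho> = 1" using d e(2) by (auto dest: dvd_imp_le)
      then show ?thesis using ord e(2) vc[OF \<rho>] by (simp add: gcd_in_def)
    qed
    have \<sigma>: "\<alpha> \<sigma> = 1" "gcd_in X R e (v \<sigma>) = 1"
      using full[of \<sigma>] omit[of \<tau>] T vc unfolding T' by auto
    have \<tau>: "\<alpha> \<tau> = 1" "gcd_in X R e (v \<tau>) = 1"
      using full[of \<tau>] omit[of \<sigma>] T vc unfolding T' by auto
    have "v \<sigma> \<noteq> v \<tau>"
      using inj_on_nontrivial_family[of v] v T by (auto simp: inj_on_def)
    moreover have "(\<Otimes>\<rho>\<in>?T. v \<rho> [^] \<alpha> \<rho>) = v \<sigma> \<otimes> v \<tau>"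
      using T vc \<sigma> \<tau> by simp
    moreover have "decomposition_basis X R {v \<sigma>, v \<tau>}" using basis T by simp
    ultimately show ?thesis using desc \<sigma> \<tau>
      by (intro exI[of _ "v \<sigma>"] exI[of _ "v \<tau>"]) simp
  qed
  ultimately show ?thesis using desc basis rat e(1) by blast
qed

end
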